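(* For every bounded core-CEPL expression $\phi$ (with $n$-ary selection formulas) there exists an equivalent Register Match Automaton, i.e. an RMA $A_\phi$ such that for every stream $S$, every index $i\in\mathbb{N}$ and every set $M$ of stream indices, $$M \in \llbracket A_\phi \rrbracket(S_i) \iff \text{there exists a valuation } v \text{ such that } M \in \llbracket \phi \rrbracket(S,i,v).$$
   Context: **Events and streams.** Fix a schema $\mathcal{R}$, a finite set of relation names (event types). $\mathit{tuples}(\mathcal{R})$ is the set of all events (tuples); each event $t$ has a type $\mathit{type}(t)\in\mathcal{R}$ and attribute values. A stream $S=t_0t_1t_2\cdots$ is a (finite or infinite) sequence of events; $S_i=t_it_{i+1}\cdots$ is the sub-stream starting at index $i$, with events keeping their original indices. Fix a set of predicates (relations of any finite arity) over $\mathit{tuples}(\mathcal{R})$ containing the always-true unary predicate $\mathrm{TRUE}$ and the unary predicates $\mathit{type}(z)=R$ for $R\in\mathcal{R}$. A selection formula $f(x_1,\dots,x_n)$ is a Boolean combination of atomic formulas over these predicates; $\mathit{var}(f)$ is its set of variables. **Core-CEPL.** Expressions are given by the grammar $\phi := R\ \mathrm{AS}\ x \mid \phi\ \mathrm{FILTER}\ f \mid \phi\ \mathrm{OR}\ \phi \mid \phi;\phi \mid \phi^{+}$, where $R\in\mathcal R$, $x$ is a variable from a set $\mathbf{X}$, and $f$ is a selection formula. $\mathit{var}(\phi)$ is the set of all variables occurring in $\phi$ (including in filters). **Semantics.** A valuation is a partial function $v:\mathbf{X}\rightharpoonup\mathbb{N}$. For sets of indices, $M=M_1\cdot M_2$ means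 $M=M_1\cup M_2$ and $\min(M_2)>\max(M_1)$. Matches are nonempty finite sets of indices. $M\in\llbracket\phi\rrbracket(S,i,v)$ is defined by: - $\phi=R\ \mathrm{AS}\ x$: $M=\{v(x)\}$, $v(x)\ge i$ and $\mathit{type}(t_{v(x)})=R$; - $\phi=\psi\ \mathrm{FILTER}\ f(x_1,\dots,x_n)$: $M\in\llbracket\psi\rrbracket(S,i,v)$ and $f(t_{v(x_1)},\dots,t_{v(x_n)})$ is true; - $\phi=\phi_1\ \mathrm{OR}\ \phi_2$: $M\in\llbracket\phi_1\rrbracket(S,i,v)$ or $M\in\llbracket\phi_2\rrbracket(S,i,v)$; - $\phi=\phi_1;\phi_2$: $M=M_1\cdot M_2$ with $M_1\in\llbracket\phi_1\rrbracket(S,i,v)$ and $M_2\in\llbracket\phi_2\rrbracket(S,\max(M_1)+1,v)$; - $\phi=\psi^+$: for some $n\ge1$, $M=M_1\cdot M_2\cdots M_n$ with $M_1\in\llbracket\psi\rrbracket(S,i,v)$ and, for $2\le j\le n$, $M_j\in\llbracket\psi\rrbracket(S,\max(M_{j-1})+1,v_j)$ for some valuation $v_j$ that agrees with $v$ except possibly on the variables defined (by a clause $R\ \mathrm{AS}\ x$) in $\psi$ outside the scope of every $^+$ operator of $\psi$. **Bounded expressions.** $\mathit{bound}(R\ \mathrm{AS}\ x)=\{x\}$, $\mathit{bound}(\psi\ \mathrm{FILTER}\ f)=\mathit{bound}(\psi)$, $\mathit{bound}(\phi_1\ \mathrm{OR}\ \phi_2)=\mathit{bound}(\phi_1)\cap\mathit{bound}(\phi_2)$,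 $\mathit{bound}(\phi_1;\phi_2)=\mathit{bound}(\phi_1)\cup\mathit{bound}(\phi_2)$, $\mathit{bound}(\psi^+)=\emptyset$. $\phi$ is well-formed if for every sub-expression $\rho\ \mathrm{FILTER}\ f$ and every $x\in\mathit{var}(f)$ there is a sub-expression $\psi$ of $\phi$ having $\rho$ as a sub-expression with $x\in\mathit{bound}(\psi)$. $\phi$ is bounded if it is well-formed and: $\phi=R\ \mathrm{AS}\ x$; or $\phi=\psi\ \mathrm{FILTER}\ f$ with $\psi$ bounded and $\mathit{var}(f)\subseteq\mathit{bound}(\psi)$; or $\phi$ is $\phi_1\ \mathrm{OR}\ \phi_2$, $\phi_1;\phi_2$ or $\psi^+$ with all its sub-expressions bounded and, in the case $\phi_1;\phi_2$, $\mathit{var}(\phi_1)\cap\mathit{var}(\phi_2)=\emptyset$. **RMA.** A Register Match Automaton is a tuple $(Q,Q^s,Q^f,RG,\Delta)$: $Q$ a finite set of states, $Q^s\subseteq Q$ start states, $Q^f\subseteq Q$ final states, $RG$ a finite set of registers, $\Delta$ a finite set of transitions. A transition is either an $\epsilon$-transition from a state $q$ to a state $p$, or a tuple $(q,f,rs)\to(p,R,o)$ with $q,p\in Q$, $f$ a selection formula, $rs=(r_1,\dots,r_n)$ the register selection with $r_j\in RG\cup\{\sim\}$, $R\subseteq RG$ the write registers, and output $o\in\{\circ,\bullet\}$. Register contents are a function $\gamma$ on $RG\cup\{\sim\}$, with $\gamma(\sim)$ the current event being consumed; $\sharp$ denotes an empty register. A non-$\epsilon$ transition applies on consuming an event if $f(\gamma(r_1),\dots,\gamma(r_n))$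 is true; an $\epsilon$-transition applies without consuming an event. Standing structural requirement: for every state $q$ and register $r\in RG$ in the register selection of a transition leaving $q$, every trail to $q$ (sequence of successive transitions from a start state to $q$ without state re-visits) contains a transition with $r$ among its write registers (so transitions from a start state use only $\sim$). A configuration is $[i,q,\gamma]$ ($i$ = index of next event, $q$ = state, $\gamma$ = register contents). $[i',q',\gamma']$ is a successor of $[i,q,\gamma]$ via an applicable transition $\delta$ from $q$ to $q'$ if: for $\delta$ an $\epsilon$-transition, $i'=i$ and $\gamma'=\gamma$; otherwise $i'=i+1$, $\gamma'(r)=t_i$ for $r\in R$ and $\gamma'(r)=\gamma(r)$ for $r\in RG\setminus R$. A run over $S$ (respectively over $S_i$) is a finite sequence of successor configurations starting at index $0$ (respectively $i$), in a start state, with all registers empty. A run is accepting if its last state is in $Q^f$ and the output of its last event-consuming transition is $\bullet$. $\mathit{match}(\varrho)$ is the set of indices $j$ such that the transition of $\varrho$ consuming $t_j$ has output $\bullet$. $\llbracket A\rrbracket(S)=\{\mathit{match}(\varrho):\varrho \text{ an accepting run of } A \text{ over } S\}$, and similarly for $S_i$. *)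

theory Defs
  imports Main
begin

section \<open>Events, streams and selection formulas\<close>

datatype (events: 'e) evstream = FinStream "'e list" | InfStream "nat \<Rightarrow> 'e"

fun event_at :: "'e evstream \<Rightarrow> nat \<Rightarrow> 'e option" where
  "event_at (FinStream ts) i = (if i < length ts then Some (ts ! i) else None)"
| "event_at (InfStream t) i = Some (t i)"

text \<open>A predicate is a relation together with its arity; tuples of events are lists.\<close>

type_synonym 'e evpred = "nat \<times> 'e list set"

locale cepl_setting =
  fixes Rel :: "'r set"
    and tuples :: "'e set"
    and ty :: "'e \<Rightarrow> 'r"
    and P :: "'e evpred set"
  assumes finite_schema: "finite Rel"
    and type_in_schema: "t \<in> tuples \<Longrightarrow> ty t \<in> Rel"
    and pred_arity: "(n, rel) \<in> P \<Longrightarrow> rel \<subseteq> {ts. length ts = n \<and> set ts \<subseteq> tuples}"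
    and pred_TRUE: "(1, {[t] | t. t \<in> tuples}) \<in> P"
    and pred_type: "R \<in> Rel \<Longrightarrow> (1, {[t] | t. t \<in> tuples \<and> ty t = R}) \<in> P"

datatype ('e, 'x) formula =
    Atom "'e evpred" "'x list"
  | Neg "('e, 'x) formula"
  | Conj "('e, 'x) formula" "('e, 'x) formula"
  | Disj "('e, 'x) formula" "('e, 'x) formula"

primrec fvars :: "('e, 'x) formula \<Rightarrow> 'x set" where
  "fvars (Atom p xs) = set xs"
| "fvars (Neg f) = fvars f"
| "fvars (Conj f g) = fvars f \<union> fvars g"
| "fvars (Disj f g) = fvars f \<union> fvars g"

primrec formula_over :: "'e evpred set \<Rightarrow> ('e, 'x) formula \<Rightarrow> bool" where
  "formula_over P (Atom p xs) \<longleftrightarrow> p \<in> P \<and> length xs = fst p"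
| "formula_over P (Neg f) \<longleftrightarrow> formula_over P f"
| "formula_over P (Conj f g) \<longleftrightarrow> formula_over P f \<and> formula_over P g"
| "formula_over P (Disj f g) \<longleftrightarrow> formula_over P f \<and> formula_over P g"

primrec holds :: "('x \<Rightarrow> 'e) \<Rightarrow> ('e, 'x) formula \<Rightarrow> bool" where
  "holds a (Atom p xs) \<longleftrightarrow> map a xs \<in> snd p"
| "holds a (Neg f) \<longleftrightarrow> \<not> holds a f"
| "holds a (Conj f g) \<longleftrightarrow> holds a f \<and> holds a g"
| "holds a (Disj f g) \<longleftrightarrow> holds a f \<or> holds a g"

text \<open>Truth under a partial assignment: a formula, negated or not, is true only if all its
  variables denote events.\<close>

definition sat :: "('x \<rightharpoonup> 'e) \<Rightarrow> ('e, 'x) formula \<Rightarrow> bool" where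
  "sat a f \<longleftrightarrow> fvars f \<subseteq> dom a \<and> holds (\<lambda>x. the (a x)) f"


section \<open>Core-CEPL\<close>

datatype ('r, 'e, 'x) cepl =
    As 'r 'x
  | Filter "('r, 'e, 'x) cepl" "('e, 'x) formula"
  | Or "('r, 'e, 'x) cepl" "('r, 'e, 'x) cepl"
  | Seq "('r, 'e, 'x) cepl" "('r, 'e, 'x) cepl"
  | Plus "('r, 'e, 'x) cepl"

primrec cepl_over :: "'r set \<Rightarrow> 'e evpred set \<Rightarrow> ('r, 'e, 'x) cepl \<Rightarrow> bool" where
  "cepl_over Rel P (As R x) \<longleftrightarrow> R \<in> Rel"
| "cepl_over Rel P (Filter \<psi> f) \<longleftrightarrow> cepl_over Rel P \<psi> \<and> formula_over P f"
| "cepl_over Rel P (Or \<phi>\<^sub>1 \<phi>\<^sub>2) \<longleftrightarrow> cepl_over Rel P \<phi>\<^sub>1 \<and> cepl_over Rel P \<phi>\<^sub>2"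
| "cepl_over Rel P (Seq \<phi>\<^sub>1 \<phi>\<^sub>2) \<longleftrightarrow> cepl_over Rel P \<phi>\<^sub>1 \<and> cepl_over Rel P \<phi>\<^sub>2"
| "cepl_over Rel P (Plus \<psi>) \<longleftrightarrow> cepl_over Rel P \<psi>"

primrec cvars :: "('r, 'e, 'x) cepl \<Rightarrow> 'x set" where
  "cvars (As R x) = {x}"
| "cvars (Filter \<psi> f) = cvars \<psi> \<union> fvars f"
| "cvars (Or \<phi>\<^sub>1 \<phi>\<^sub>2) = cvars \<phi>\<^sub>1 \<union> cvars \<phi>\<^sub>2"
| "cvars (Seq \<phi>\<^sub>1 \<phi>\<^sub>2) = cvars \<phi>\<^sub>1 \<union> cvars \<phi>\<^sub>2"
| "cvars (Plus \<psi>) = cvars \<psi>"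

text \<open>Variables defined by an \<open>As\<close> clause outside the scope of every \<open>Plus\<close>.\<close>

primrec defvars :: "('r, 'e, 'x) cepl \<Rightarrow> 'x set" where
  "defvars (As R x) = {x}"
| "defvars (Filter \<psi> f) = defvars \<psi>"
| "defvars (Or \<phi>\<^sub>1 \<phi>\<^sub>2) = defvars \<phi>\<^sub>1 \<union> defvars \<phi>\<^sub>2"
| "defvars (Seq \<phi>\<^sub>1 \<phi>\<^sub>2) = defvars \<phi>\<^sub>1 \<union> defvars \<phi>\<^sub>2"
| "defvars (Plus \<psi>) = {}"

text \<open>In the clause for \<open>Plus\<close>, the list \<open>Ms\<close> holds \<open>M\<^sub>1, \<dots>, M\<^sub>n\<close> and \<open>vs\<close> the
  valuations used for them; the first of these is \<open>v\<close> itself. All sets in the semantics are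
  finite and nonempty (lemma \<open>cepl_sem_finite_nonempty\<close> below), so \<open>Min\<close> and \<open>Max\<close> are
  meaningful.\<close>

primrec cepl_sem ::
  "('e \<Rightarrow> 'r) \<Rightarrow> ('r, 'e, 'x) cepl \<Rightarrow> 'e evstream \<Rightarrow> nat \<Rightarrow> ('x \<rightharpoonup> nat) \<Rightarrow> nat set set" where
  "cepl_sem ty (As R x) S i v =
     {M. \<exists>k t. v x = Some k \<and> M = {k} \<and> k \<ge> i \<and> event_at S k = Some t \<and> ty t = R}"
| "cepl_sem ty (Filter \<psi> f) S i v =
     {M \<in> cepl_sem ty \<psi> S i v. sat (event_at S \<circ>\<^sub>m v) f}"
| "cepl_sem ty (Or \<phi>\<^sub>1 \<phi>\<^sub>2) S i v = cepl_sem ty \<phi>\<^sub>1 S i v \<union> cepl_sem ty \<phi>\<^sub>2 S i v"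
| "cepl_sem ty (Seq \<phi>\<^sub>1 \<phi>\<^sub>2) S i v =
     {M. \<exists>M\<^sub>1 M\<^sub>2. M = M\<^sub>1 \<union> M\<^sub>2 \<and> Min M\<^sub>2 > Max M\<^sub>1 \<and>
           M\<^sub>1 \<in> cepl_sem ty \<phi>\<^sub>1 S i v \<and> M\<^sub>2 \<in> cepl_sem ty \<phi>\<^sub>2 S (Max M\<^sub>1 + 1) v}"
| "cepl_sem ty (Plus \<psi>) S i v =
     {M. \<exists>Ms vs. Ms \<noteq> [] \<and> length vs = length Ms \<and>
           M = \<Union>(set Ms) \<and>
           (\<forall>j. 0 < j \<and> j < length Ms \<longrightarrow> Min (Ms ! j) > Max (Ms ! (j - 1))) \<and>
           vs ! 0 = v \<and> Ms ! 0 \<in> cepl_sem ty \<psi> S i v \<and>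
           (\<forall>j. 0 < j \<and> j < length Ms \<longrightarrow>
              (\<forall>x. x \<notin> defvars \<psi> \<longrightarrow> (vs ! j) x = v x) \<and>
              Ms ! j \<in> cepl_sem ty \<psi> S (Max (Ms ! (j - 1)) + 1) (vs ! j))}"

lemma cepl_sem_finite_nonempty:
  "M \<in> cepl_sem ty \<phi> S i v \<Longrightarrow> finite M \<and> M \<noteq> {}"
proof (induction \<phi> arbitrary: M i v)
  case (Plus \<psi>)
  then obtain Ms vs where "Ms \<noteq> [] \<and> M = \<Union>(set Ms) \<and> Ms ! 0 \<in> cepl_sem ty \<psi> S i v \<and>
    (\<forall>j. 0 < j \<and> j < length Ms \<longrightarrow>
      Ms ! j \<in> cepl_sem ty \<psi> S (Max (Ms ! (j - 1)) + 1) (vs ! j))"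
    unfolding cepl_sem.simps mem_Collect_eq by metis
  then have Ms: "Ms \<noteq> []" "M = \<Union>(set Ms)" "Ms ! 0 \<in> cepl_sem ty \<psi> S i v"
    and rest: "\<And>j. 0 < j \<Longrightarrow> j < length Ms \<Longrightarrow>
      Ms ! j \<in> cepl_sem ty \<psi> S (Max (Ms ! (j - 1)) + 1) (vs ! j)"
    by blast+
  have "finite (Ms ! j) \<and> Ms ! j \<noteq> {}" if "j < length Ms" for j
    using that Plus.IH Ms(3) rest by (cases "j = 0") (simp_all, blast+)
  then have "\<forall>N \<in> set Ms. finite N \<and> N \<noteq> {}"
    by (metis in_set_conv_nth)
  with Ms(1,2) show ?case
    by (cases Ms) auto
qed (auto, blast+)


section \<open>Bounded expressions\<close>

primrec bound :: "('r, 'e, 'x) cepl \<Rightarrow> 'x set" where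
  "bound (As R x) = {x}"
| "bound (Filter \<psi> f) = bound \<psi>"
| "bound (Or \<phi>\<^sub>1 \<phi>\<^sub>2) = bound \<phi>\<^sub>1 \<inter> bound \<phi>\<^sub>2"
| "bound (Seq \<phi>\<^sub>1 \<phi>\<^sub>2) = bound \<phi>\<^sub>1 \<union> bound \<phi>\<^sub>2"
| "bound (Plus \<psi>) = {}"

text \<open>Every expression counts as a sub-expression of itself.\<close>

primrec subexprs :: "('r, 'e, 'x) cepl \<Rightarrow> ('r, 'e, 'x) cepl set" where
  "subexprs (As R x) = {As R x}"
| "subexprs (Filter \<psi> f) = insert (Filter \<psi> f) (subexprs \<psi>)"
| "subexprs (Or \<phi>\<^sub>1 \<phi>\<^sub>2) = insert (Or \<phi>\<^sub>1 \<phi>\<^sub>2) (subexprs \<phi>\<^sub>1 \<union> subexprs \<phi>\<^sub>2)"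
| "subexprs (Seq \<phi>\<^sub>1 \<phi>\<^sub>2) = insert (Seq \<phi>\<^sub>1 \<phi>\<^sub>2) (subexprs \<phi>\<^sub>1 \<union> subexprs \<phi>\<^sub>2)"
| "subexprs (Plus \<psi>) = insert (Plus \<psi>) (subexprs \<psi>)"

definition well_formed :: "('r, 'e, 'x) cepl \<Rightarrow> bool" where
  "well_formed \<phi> \<longleftrightarrow>
     (\<forall>\<rho> f. Filter \<rho> f \<in> subexprs \<phi> \<longrightarrow>
        (\<forall>x \<in> fvars f. \<exists>\<psi> \<in> subexprs \<phi>. \<rho> \<in> subexprs \<psi> \<and> x \<in> bound \<psi>))"

primrec bounded :: "('r, 'e, 'x) cepl \<Rightarrow> bool" where
  "bounded (As R x) \<longleftrightarrow> well_formed (As R x :: ('r, 'e, 'x) cepl)"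
| "bounded (Filter \<psi> f) \<longleftrightarrow>
     well_formed (Filter \<psi> f) \<and> bounded \<psi> \<and> fvars f \<subseteq> bound \<psi>"
| "bounded (Or \<phi>\<^sub>1 \<phi>\<^sub>2) \<longleftrightarrow> well_formed (Or \<phi>\<^sub>1 \<phi>\<^sub>2) \<and> bounded \<phi>\<^sub>1 \<and> bounded \<phi>\<^sub>2"
| "bounded (Seq \<phi>\<^sub>1 \<phi>\<^sub>2) \<longleftrightarrow>
     well_formed (Seq \<phi>\<^sub>1 \<phi>\<^sub>2) \<and> bounded \<phi>\<^sub>1 \<and> bounded \<phi>\<^sub>2 \<and> cvars \<phi>\<^sub>1 \<inter> cvars \<phi>\<^sub>2 = {}"
| "bounded (Plus \<psi>) \<longleftrightarrow> well_formed (Plus \<psi>) \<and> bounded \<psi>"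


section \<open>Register Match Automata\<close>

text \<open>\<open>Cur\<close> is the pseudo-register \<open>\<sim>\<close> holding the event being consumed. The outputs
  \<open>Skip\<close> and \<open>Mark\<close> stand for the empty and the filled bullet. A transition formula of arity
  \<open>n\<close> has the variables \<open>0, \<dots>, n - 1\<close>, where \<open>k\<close> refers to position \<open>k\<close> of the register
  selection.\<close>

datatype 'g register = Cur | Reg 'g

datatype outmark = Skip | Mark

datatype ('e, 'q, 'g) transition =
    Eps 'q 'q
  | Trans 'q "('e, nat) formula" "'g register list" 'q "'g set" outmark

fun src :: "('e, 'q, 'g) transition \<Rightarrow> 'q" where
  "src (Eps q p) = q"
| "src (Trans q f rs p R out) = q"

fun tgt :: "('e, 'q, 'g) transition \<Rightarrow> 'q" where
  "tgt (Eps q p) = p"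
| "tgt (Trans q f rs p R out) = p"

fun reads :: "('e, 'q, 'g) transition \<Rightarrow> 'g set" where
  "reads (Eps q p) = {}"
| "reads (Trans q f rs p R out) = {r. Reg r \<in> set rs}"

fun writes :: "('e, 'q, 'g) transition \<Rightarrow> 'g set" where
  "writes (Eps q p) = {}"
| "writes (Trans q f rs p R out) = R"

fun output_of :: "('e, 'q, 'g) transition \<Rightarrow> outmark option" where
  "output_of (Eps q p) = None"
| "output_of (Trans q f rs p R out) = Some out"

fun formula_ok :: "'e evpred set \<Rightarrow> ('e, 'q, 'g) transition \<Rightarrow> bool" where
  "formula_ok P (Eps q p) \<longleftrightarrow> True"
| "formula_ok P (Trans q f rs p R out) \<longleftrightarrow> formula_over P f \<and> fvars f = {..<length rs}"

record ('e, 'q, 'g) rma =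
  states :: "'q set"
  starts :: "'q set"
  finals :: "'q set"
  registers :: "'g set"
  transitions :: "('e, 'q, 'g) transition set"

fun path :: "('e, 'q, 'g) rma \<Rightarrow> 'q \<Rightarrow> ('e, 'q, 'g) transition list \<Rightarrow> 'q \<Rightarrow> bool" where
  "path A q [] p \<longleftrightarrow> q = p"
| "path A q (d # ds) p \<longleftrightarrow> d \<in> transitions A \<and> src d = q \<and> path A (tgt d) ds p"

definition trail_to :: "('e, 'q, 'g) rma \<Rightarrow> ('e, 'q, 'g) transition list \<Rightarrow> 'q \<Rightarrow> bool" where
  "trail_to A ds q \<longleftrightarrow>
     (\<exists>q\<^sub>0 \<in> starts A. path A q\<^sub>0 ds q \<and> distinct (q\<^sub>0 # map tgt ds))"

definition is_rma :: "'e evpred set \<Rightarrow> ('e, 'q, 'g) rma \<Rightarrow> bool" where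
  "is_rma P A \<longleftrightarrow>
     finite (states A) \<and> starts A \<subseteq> states A \<and> finals A \<subseteq> states A \<and>
     finite (registers A) \<and> finite (transitions A) \<and>
     (\<forall>d \<in> transitions A. src d \<in> states A \<and> tgt d \<in> states A \<and> formula_ok P d \<and>
        reads d \<subseteq> registers A \<and> writes d \<subseteq> registers A) \<and>
     (\<forall>d \<in> transitions A. \<forall>r \<in> reads d. \<forall>ds.
        trail_to A ds (src d) \<longrightarrow> (\<exists>d' \<in> set ds. r \<in> writes d'))"

text \<open>Register contents are partial functions, undefined on empty registers.\<close>

type_synonym ('e, 'q, 'g) config = "nat \<times> 'q \<times> ('g \<rightharpoonup> 'e)"

fun content :: "('g \<rightharpoonup> 'e) \<Rightarrow> 'e \<Rightarrow> 'g register \<rightharpoonup> 'e" where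
  "content \<gamma> t Cur = Some t"
| "content \<gamma> t (Reg r) = \<gamma> r"

fun succ_config ::
  "'e evstream \<Rightarrow> ('e, 'q, 'g) config \<Rightarrow> ('e, 'q, 'g) transition \<Rightarrow> ('e, 'q, 'g) config \<Rightarrow> bool"
where
  "succ_config S (i, q, \<gamma>) (Eps p p') (i', q', \<gamma>') \<longleftrightarrow>
     q = p \<and> q' = p' \<and> i' = i \<and> \<gamma>' = \<gamma>"
| "succ_config S (i, q, \<gamma>) (Trans p f rs p' R out) (i', q', \<gamma>') \<longleftrightarrow>
     q = p \<and> q' = p' \<and> i' = i + 1 \<and>
     (\<exists>t. event_at S i = Some t \<and>
        sat (\<lambda>k. if k < length rs then content \<gamma> t (rs ! k) else None) f \<and>
        \<gamma>' = (\<lambda>r. if r \<in> R then Some t else \<gamma> r))"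

text \<open>A run is an initial configuration \<open>c\<close> with a list of steps, each recording the
  transition taken and the configuration reached.\<close>

type_synonym ('e, 'q, 'g) run =
  "('e, 'q, 'g) config \<times> (('e, 'q, 'g) transition \<times> ('e, 'q, 'g) config) list"

fun steps_from ::
  "('e, 'q, 'g) rma \<Rightarrow> 'e evstream \<Rightarrow> ('e, 'q, 'g) config \<Rightarrow>
   (('e, 'q, 'g) transition \<times> ('e, 'q, 'g) config) list \<Rightarrow> bool"
where
  "steps_from A S c [] \<longleftrightarrow> True"
| "steps_from A S c ((d, c') # w) \<longleftrightarrow>
     d \<in> transitions A \<and> succ_config S c d c' \<and> steps_from A S c' w"

fun configs :: "('e, 'q, 'g) run \<Rightarrow> ('e, 'q, 'g) config list" where
  "configs (c, w) = c # map snd w"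

text \<open>Runs over the sub-stream \<open>S\<^sub>i\<close>, whose events keep their indices in \<open>S\<close>.\<close>

definition is_run :: "('e, 'q, 'g) rma \<Rightarrow> 'e evstream \<Rightarrow> nat \<Rightarrow> ('e, 'q, 'g) run \<Rightarrow> bool" where
  "is_run A S i \<rho> \<longleftrightarrow>
     (\<exists>q \<in> starts A. fst \<rho> = (i, q, Map.empty)) \<and> steps_from A S (fst \<rho>) (snd \<rho>)"

definition run_outputs :: "('e, 'q, 'g) run \<Rightarrow> outmark list" where
  "run_outputs \<rho> = List.map_filter (\<lambda>(d, c). output_of d) (snd \<rho>)"

definition accepting :: "('e, 'q, 'g) rma \<Rightarrow> ('e, 'q, 'g) run \<Rightarrow> bool" where
  "accepting A \<rho> \<longleftrightarrow>
     fst (snd (last (configs \<rho>))) \<in> finals A \<and>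
     run_outputs \<rho> \<noteq> [] \<and> last (run_outputs \<rho>) = Mark"

text \<open>The \<open>k\<close>-th step leaves the \<open>k\<close>-th configuration, whose index is that of the event
  consumed.\<close>

definition match_of :: "('e, 'q, 'g) run \<Rightarrow> nat set" where
  "match_of \<rho> = {fst (configs \<rho> ! k) | k.
     k < length (snd \<rho>) \<and> output_of (fst (snd \<rho> ! k)) = Some Mark}"

definition rma_sem :: "('e, 'q, 'g) rma \<Rightarrow> 'e evstream \<Rightarrow> nat \<Rightarrow> nat set set" where
  "rma_sem A S i = {match_of \<rho> | \<rho>. is_run A S i \<rho> \<and> accepting A \<rho>}"

end

theory Submission
  imports Defs
begin

text \<open>An expression is translated into a language of words over letters \<open>(x, F, b)\<close>, read as
  ``bind \<open>x\<close> to the event being marked, then test \<open>F\<close>''; a filter is conjoined to the last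
  letter, since boundedness guarantees that its variables are bound by then. Because the later
  iterations of a \<open>Plus\<close> may rebind only the variables defined outside inner \<open>Plus\<close> operators,
  any other variable can be bound at most once in all iterations together, and conversely words
  with this property come from a valuation. All of these operations preserve the finiteness
  of the set of residuals, and an automaton on the residuals, with one register per variable and
  a loop that skips events, accepts the required matches.\<close>


section \<open>Languages with finitely many residuals\<close>

text \<open>Looping an automaton for \<open>\<psi>\<close> does not give one for
  \<open>Plus \<psi>\<close>. Take \<open>\<psi> = Seq (Plus (As R y)) (As Q z)\<close> with
  \<open>R\<close> and \<open>Q\<close> different: \<open>y\<close> is not in
  \<open>defvars \<psi>\<close>, so all outer iterations share its value, each must mark that event
  in its first inner iteration, and only one outer iteration is possible. A loop would also accept
  \<open>R\<close>, \<open>Q\<close>, \<open>R\<close>, \<open>Q\<close>. This constraint concerns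
  the whole word. It needs finite memory only because finitely many variables occur: it suffices to
  know which of them were already bound visibly. For languages such a condition is a mere
  intersection, which is why expressions are not composed at the level of automata. Words also
  separate two roles of a binding. Tests look at the latest binding of a variable, as a register
  does; the valuation is tied only to the flagged letters. Boundedness makes both agree where a
  filter looks. The structural requirement on registers is not carried through the operations but
  derived once, from a property of the words.\<close>

definition deriv :: "'a \<Rightarrow> 'a list set \<Rightarrow> 'a list set" where
  "deriv a L = {u. a # u \<in> L}"

definition derivs :: "'a list \<Rightarrow> 'a list set \<Rightarrow> 'a list set" where
  "derivs u L = {w. u @ w \<in> L}"

lemma derivs_Nil [simp]: "derivs [] L = L"
  by (simp add: derivs_def)

lemma derivs_Cons [simp]: "derivs (a # u) L = derivs u (deriv a L)"
  by (simp add: derivs_def deriv_def)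

text \<open>The type of letters may be infinite, hence the finite alphabet. Any finite family closed
  under \<open>deriv\<close> will do, so the exact set of residuals never has to be
  computed.\<close>

definition regular_via :: "'a list set set \<Rightarrow> 'a set \<Rightarrow> 'a list set \<Rightarrow> bool" where
  "regular_via \<K> \<Sigma> L \<longleftrightarrow>
     finite \<K> \<and> finite \<Sigma> \<and> L \<in> \<K> \<and> (\<forall>K \<in> \<K>. K \<subseteq> lists \<Sigma> \<and> (\<forall>a. deriv a K \<in> \<K>))"

definition regular :: "'a list set \<Rightarrow> bool" where
  "regular L \<longleftrightarrow> (\<exists>\<K> \<Sigma>. regular_via \<K> \<Sigma> L)"

lemma regularI:
  assumes "finite \<K>" "finite \<Sigma>" "L \<in> \<K>"
    and "\<And>K. K \<in> \<K> \<Longrightarrow> K \<subseteq> lists \<Sigma>"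
    and "\<And>K a. K \<in> \<K> \<Longrightarrow> deriv a K \<in> \<K>"
  shows "regular L"
  unfolding regular_def regular_via_def
  by (intro exI[of _ \<K>] exI[of _ \<Sigma>]) (simp add: assms)

lemma regularE:
  assumes "regular L"
  obtains \<K> \<Sigma> where "finite \<K>" "finite \<Sigma>" "L \<in> \<K>"
    and "\<And>K. K \<in> \<K> \<Longrightarrow> K \<subseteq> lists \<Sigma>"
    and "\<And>K a. K \<in> \<K> \<Longrightarrow> deriv a K \<in> \<K>"
proof -
  from assms obtain \<K> \<Sigma> where "regular_via \<K> \<Sigma> L"
    unfolding regular_def by (elim exE)
  then show ?thesis by (intro that[of \<K> \<Sigma>]) (simp_all add: regular_via_def)
qed

section \<open>Closure of \<open>regular\<close> under the operations that build
  \<open>lang\<close>\<close>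

lemma regular_singleton: "regular {[a]}"
proof (rule regularI[of "{{[a]}, {[]}, {}}" "{a}"])
  fix K b assume "K \<in> {{[a]}, {[]}, {}}"
  then show "deriv b K \<in> {{[a]}, {[]}, {}}"
    by (cases "a = b") (auto simp: deriv_def)
qed auto

lemma regular_Un:
  assumes "regular L" "regular M"
  shows "regular (L \<union> M)"
proof -
  from assms(1) obtain \<K> \<Sigma> where K: "finite \<K>" "finite \<Sigma>" "L \<in> \<K>"
    "\<And>K. K \<in> \<K> \<Longrightarrow> K \<subseteq> lists \<Sigma>" "\<And>K a. K \<in> \<K> \<Longrightarrow> deriv a K \<in> \<K>"
    by (rule regularE) blast
  from assms(2) obtain \<K>' \<Sigma>' where K': "finite \<K>'" "finite \<Sigma>'" "M \<in> \<K>'"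
    "\<And>K. K \<in> \<K>' \<Longrightarrow> K \<subseteq> lists \<Sigma>'" "\<And>K a. K \<in> \<K>' \<Longrightarrow> deriv a K \<in> \<K>'"
    by (rule regularE) blast
  let ?\<K> = "(\<lambda>(K, K'). K \<union> K') ` (\<K> \<times> \<K>')"
  show ?thesis
  proof (rule regularI[of ?\<K> "\<Sigma> \<union> \<Sigma>'"])
    fix N assume "N \<in> ?\<K>"
    then obtain K1 K2 where N: "N = K1 \<union> K2" "K1 \<in> \<K>" "K2 \<in> \<K>'" by auto
    show "N \<subseteq> lists (\<Sigma> \<union> \<Sigma>')" 
      using K(4)[OF N(2)] K'(4)[OF N(3)] unfolding N(1) by auto
    fix a
    have "deriv a N = deriv a K1 \<union> deriv a K2" by (auto simp: N deriv_def)
    then show "deriv a N \<in> ?\<K>" using K(5)[OF N(2)] K'(5)[OF N(3)] by auto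
  qed (use K K' in auto)
qed

definition conc :: "'a list set \<Rightarrow> 'a list set \<Rightarrow> 'a list set" where
  "conc L M = {u @ w | u w. u \<in> L \<and> w \<in> M}"

lemma deriv_conc:
  "deriv a (conc L M) = conc (deriv a L) M \<union> (if [] \<in> L then deriv a M else {})"
  unfolding deriv_def conc_def by (auto simp: Cons_eq_append_conv)

lemma conc_subset_lists: "L \<subseteq> lists A \<Longrightarrow> M \<subseteq> lists B \<Longrightarrow> conc L M \<subseteq> lists (A \<union> B)"
  unfolding conc_def in_lists_conv_set subset_iff mem_Collect_eq by (metis UnCI Un_iff set_append)

lemma regular_conc:
  assumes "regular L" "regular M"
  shows "regular (conc L M)"
proof -
  from assms(1) obtain \<K> \<Sigma> where K: "finite \<K>" "finite \<Sigma>" "L \<in> \<K>"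
    "\<And>K. K \<in> \<K> \<Longrightarrow> K \<subseteq> lists \<Sigma>" "\<And>K a. K \<in> \<K> \<Longrightarrow> deriv a K \<in> \<K>"
    by (rule regularE) blast
  from assms(2) obtain \<K>' \<Sigma>' where K': "finite \<K>'" "finite \<Sigma>'" "M \<in> \<K>'"
    "\<And>K. K \<in> \<K>' \<Longrightarrow> K \<subseteq> lists \<Sigma>'" "\<And>K a. K \<in> \<K>' \<Longrightarrow> deriv a K \<in> \<K>'"
    by (rule regularE) blast
  \<comment> \<open>A residual of \<open>conc L M\<close> is a residual of \<open>L\<close> still
    followed by \<open>M\<close>, together with residuals of \<open>M\<close> for the ways in which
    a word of \<open>L\<close> may have ended already.\<close>
  let ?f = "\<lambda>(K, \<N>). conc K M \<union> \<Union>\<N>"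
  let ?\<K> = "?f ` (\<K> \<times> Pow \<K>')"
  show ?thesis
  proof (rule regularI[of ?\<K> "\<Sigma> \<union> \<Sigma>'"])
    have "conc L M = ?f (L, {})" by simp
    then show "conc L M \<in> ?\<K>" using K(3) by blast
  next
    fix N assume "N \<in> ?\<K>"
    then obtain K1 \<N> where N: "N = conc K1 M \<union> \<Union>\<N>" "K1 \<in> \<K>" "\<N> \<subseteq> \<K>'" by auto
    have "\<N> \<subseteq> Pow (lists \<Sigma>')" using N(3) K'(4) by (meson PowI subset_iff)
    then have "\<Union>\<N> \<subseteq> lists (\<Sigma> \<union> \<Sigma>')" by auto
    then show "N \<subseteq> lists (\<Sigma> \<union> \<Sigma>')"
      using conc_subset_lists[OF K(4)[OF N(2)] K'(4)[OF K'(3)]] N(1) by simp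
    fix a
    let ?\<N> = "deriv a ` \<N> \<union> (if [] \<in> K1 then {deriv a M} else {})"
    have "deriv a N = deriv a (conc K1 M) \<union> \<Union>(deriv a ` \<N>)"
      by (auto simp: N deriv_def)
    also have "\<dots> = ?f (deriv a K1, ?\<N>)"
      by (auto simp: deriv_conc)
    finally have "deriv a N = ?f (deriv a K1, ?\<N>)" .
    moreover have "(deriv a K1, ?\<N>) \<in> \<K> \<times> Pow \<K>'"
      using N K(5) K'(3,5) by auto
    ultimately show "deriv a N \<in> ?\<K>" by (rule image_eqI)
  qed (use K K' in auto)
qed

inductive_set star :: "'a list set \<Rightarrow> 'a list set" for L where
  star_Nil: "[] \<in> star L"
| star_append: "u \<in> L \<Longrightarrow> w \<in> star L \<Longrightarrow> u @ w \<in> star L"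

lemma deriv_star: "deriv a (star L) = conc (deriv a L) (star L)"
proof (intro set_eqI iffI)
  fix u assume "u \<in> deriv a (star L)"
  then have "a # u \<in> star L" by (simp add: deriv_def)
  then show "u \<in> conc (deriv a L) (star L)"
  proof (induction "a # u" rule: star.induct)
    case (star_append x w)
    show ?case
    proof (cases x)
      case Nil
      then show ?thesis using star_append.hyps(3,4) by simp
    next
      case (Cons b x')
      then have "x' \<in> deriv a L" "u = x' @ w"
        using star_append.hyps(1,4) by (simp_all add: deriv_def)
      then show ?thesis using star_append.hyps(2) unfolding conc_def by blast
    qed
  qed
next
  fix u assume "u \<in> conc (deriv a L) (star L)"
  then obtain x w where "u = x @ w" "a # x \<in> L" "w \<in> star L"
    unfolding conc_def deriv_def by blast
  then show "u \<in> deriv a (star L)"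
    using star.star_append[of "a # x" L w] by (simp add: deriv_def)
qed

lemma star_subset_lists:
  assumes "L \<subseteq> lists A"
  shows "star L \<subseteq> lists A"
proof
  fix u assume "u \<in> star L"
  then show "u \<in> lists A" using assms by induction auto
qed

lemma regular_star:
  assumes "regular L"
  shows "regular (star L)"
proof -
  from assms obtain \<K> \<Sigma> where K: "finite \<K>" "finite \<Sigma>" "L \<in> \<K>"
    "\<And>K. K \<in> \<K> \<Longrightarrow> K \<subseteq> lists \<Sigma>" "\<And>K a. K \<in> \<K> \<Longrightarrow> deriv a K \<in> \<K>"
    by (rule regularE) blast
  let ?f = "\<lambda>\<N>. conc (\<Union>\<N>) (star L)"
  \<comment> \<open>\<open>star L\<close> itself need not have the form \<open>?f \<N>\<close>, but
    every later residual has it: pending residuals of \<open>L\<close>, then more factors.\<close>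
  let ?\<K> = "insert (star L) (?f ` Pow \<K>)"
  have st: "star L \<subseteq> lists \<Sigma>" using star_subset_lists[OF K(4)[OF K(3)]] .
  have ds: "deriv a (star L) = ?f {deriv a L}" for a by (simp add: deriv_star)
  show ?thesis
  proof (rule regularI[of ?\<K> "\<Sigma>"])
    fix N assume "N \<in> ?\<K>"
    then consider "N = star L" | \<N> where "N = ?f \<N>" "\<N> \<subseteq> \<K>" by auto
    then have "N \<subseteq> lists \<Sigma> \<and> (\<forall>a. deriv a N \<in> ?\<K>)"
    proof cases
      case 1
      have "deriv a (star L) \<in> ?f ` Pow \<K>" for a
        unfolding ds using K(3,5) by (intro imageI) auto
      then show ?thesis using st 1 by blast
    next
      case 2
      have "\<N> \<subseteq> Pow (lists \<Sigma>)" using 2(2) K(4) by (meson PowI subset_iff)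
      then have "\<Union>\<N> \<subseteq> lists \<Sigma>" by auto
      then have "N \<subseteq> lists \<Sigma>" using conc_subset_lists[OF _ st, of "\<Union>\<N>" \<Sigma>] 2(1) by simp
      moreover have "deriv a N \<in> ?\<K>" for a
      proof -
        let ?\<N> = "deriv a ` \<N> \<union> (if [] \<in> \<Union>\<N> then {deriv a L} else {})"
        have "deriv a (\<Union>\<N>) = \<Union>(deriv a ` \<N>)" by (auto simp: deriv_def)
        then have "deriv a N = ?f ?\<N>"
          unfolding 2(1) deriv_conc deriv_star by (auto simp: conc_def)
        moreover have "?\<N> \<in> Pow \<K>" using 2(2) K(3,5) by auto
        ultimately show ?thesis by blast
      qed
      ultimately show ?thesis by blast
    qed
    then show "N \<subseteq> lists \<Sigma>" "\<And>a. deriv a N \<in> ?\<K>" by auto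
  qed (use K in auto)
qed

lemma regular_map_image:
  assumes "regular L"
  shows "regular (map h ` L)"
proof -
  from assms obtain \<K> \<Sigma> where K: "finite \<K>" "finite \<Sigma>" "L \<in> \<K>"
    "\<And>K. K \<in> \<K> \<Longrightarrow> K \<subseteq> lists \<Sigma>" "\<And>K a. K \<in> \<K> \<Longrightarrow> deriv a K \<in> \<K>"
    by (rule regularE) blast
  let ?f = "\<lambda>\<N>. map h ` \<Union>\<N>"
  let ?\<K> = "?f ` Pow \<K>"
  show ?thesis
  proof (rule regularI[of ?\<K> "h ` \<Sigma>"])
    have "map h ` L = ?f {L}" by simp
    then show "map h ` L \<in> ?\<K>" using K(3) by blast
  next
    fix N assume "N \<in> ?\<K>"
    then obtain \<N> where N: "N = ?f \<N>" "\<N> \<subseteq> \<K>" by auto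
    have "\<N> \<subseteq> Pow (lists \<Sigma>)" using N(2) K(4) by (meson PowI subset_iff)
    then have "\<Union>\<N> \<subseteq> lists \<Sigma>" by auto
    then show "N \<subseteq> lists (h ` \<Sigma>)" unfolding N(1) lists_image by (rule image_mono)
    fix b
    \<comment> \<open>Several letters may be sent to \<open>b\<close>, so residuals become unions,
      as in the subset construction. The set stays inside the finite \<open>\<K>\<close> however
      many such \<open>a\<close> there are.\<close>
    let ?\<N> = "{deriv a K | a K. K \<in> \<N> \<and> h a = b}"
    have "deriv b N = ?f ?\<N>"
    proof
      show "deriv b N \<subseteq> ?f ?\<N>"
      proof
        fix u assume "u \<in> deriv b N"
        then obtain K z where z: "K \<in> \<N>" "z \<in> K" "b # u = map h z"
          by (auto simp: N(1) deriv_def)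
        then obtain a z' where a: "z = a # z'" "h a = b" "u = map h z'"
          by (auto simp: Cons_eq_map_conv)
        then have "z' \<in> deriv a K" using z by (simp add: deriv_def)
        then show "u \<in> ?f ?\<N>" using a z(1) by blast
      qed
      show "?f ?\<N> \<subseteq> deriv b N"
      proof
        fix u assume "u \<in> ?f ?\<N>"
        then obtain a K z where "K \<in> \<N>" "h a = b" "a # z \<in> K" "u = map h z"
          unfolding deriv_def by blast
        then have "map h (a # z) \<in> N" "b # u = map h (a # z)"
          unfolding N(1) by (blast, simp)
        then show "u \<in> deriv b N" by (simp add: deriv_def)
      qed
    qed
    moreover have "?\<N> \<in> Pow \<K>" using N(2) K(5) by auto
    ultimately show "deriv b N \<in> ?\<K>" by (rule image_eqI)
  qed (use K in auto)
qed

definition map_last :: "('a \<Rightarrow> 'a) \<Rightarrow> 'a list set \<Rightarrow> 'a list set" where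
  "map_last h L = {u @ [h a] | u a. u @ [a] \<in> L}"

lemma deriv_map_last:
  "deriv b (map_last h L) =
     map_last h (deriv b L) \<union> (if \<exists>a. [a] \<in> L \<and> h a = b then {[]} else {})"
  unfolding map_last_def deriv_def by (auto simp: Cons_eq_append_conv)

lemma regular_map_last:
  assumes "regular L"
  shows "regular (map_last h L)"
proof -
  from assms obtain \<K> \<Sigma> where K: "finite \<K>" "finite \<Sigma>" "L \<in> \<K>"
    "\<And>K. K \<in> \<K> \<Longrightarrow> K \<subseteq> lists \<Sigma>" "\<And>K a. K \<in> \<K> \<Longrightarrow> deriv a K \<in> \<K>"
    by (rule regularE) blast
  \<comment> \<open>\<open>map_last\<close> never yields the empty word; \<open>E\<close> supplies
    it once the letter just read may have been the mapped last one.\<close>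
  let ?f = "\<lambda>(K, E). map_last h K \<union> E"
  let ?\<K> = "?f ` (\<K> \<times> Pow {[]})"
  show ?thesis
  proof (rule regularI[of ?\<K> "\<Sigma> \<union> h ` \<Sigma>"])
    have "map_last h L = ?f (L, {})" by simp
    then show "map_last h L \<in> ?\<K>" using K(3) by blast
  next
    fix N assume "N \<in> ?\<K>"
    then obtain K1 E where N: "N = map_last h K1 \<union> E" "K1 \<in> \<K>" "E \<subseteq> {[]}" by auto
    have "map_last h K1 \<subseteq> lists (\<Sigma> \<union> h ` \<Sigma>)"
    proof
      fix u assume "u \<in> map_last h K1"
      then obtain w a where "u = w @ [h a]" "w @ [a] \<in> lists \<Sigma>"
        using K(4)[OF N(2)] unfolding map_last_def by blast
      then show "u \<in> lists (\<Sigma> \<union> h ` \<Sigma>)" by auto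
    qed
    then show "N \<subseteq> lists (\<Sigma> \<union> h ` \<Sigma>)" using N(1,3) by auto
    fix b
    let ?E = "if \<exists>a. [a] \<in> K1 \<and> h a = b then {[]} else {}"
    have "deriv b N = ?f (deriv b K1, ?E)"
    proof -
      have "deriv b N = deriv b (map_last h K1)" using N(1,3) by (auto simp: deriv_def)
      then show ?thesis by (simp add: deriv_map_last)
    qed
    moreover have "(deriv b K1, ?E) \<in> \<K> \<times> Pow {[]}" using N(2) K(5) by simp
    ultimately show "deriv b N \<in> ?\<K>" by (rule image_eqI)
  qed (use K in auto)
qed

lemma regular_distinct:
  assumes "regular L"
  shows "regular {u \<in> L. distinct (map g (filter p u))}"
proof -
  from assms obtain \<K> \<Sigma> where K: "finite \<K>" "finite \<Sigma>" "L \<in> \<K>"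
    "\<And>K. K \<in> \<K> \<Longrightarrow> K \<subseteq> lists \<Sigma>" "\<And>K a. K \<in> \<K> \<Longrightarrow> deriv a K \<in> \<K>"
    by (rule regularE) blast
  \<comment> \<open>\<open>A\<close> collects the \<open>g\<close>-values of the selected letters
    read so far. The extra \<open>{}\<close> in \<open>?\<K>\<close> is the residual after a
    repeated value or a letter outside \<open>\<Sigma>\<close>.\<close>
  let ?f = "\<lambda>(K, A). {u \<in> K. distinct (map g (filter p u)) \<and> g ` set (filter p u) \<inter> A = {}}"
  let ?\<K> = "insert {} (?f ` (\<K> \<times> Pow (g ` \<Sigma>)))"
  show ?thesis
  proof (rule regularI[of ?\<K> \<Sigma>])
    have "{u \<in> L. distinct (map g (filter p u))} = ?f (L, {})" by simp
    then show "{u \<in> L. distinct (map g (filter p u))} \<in> ?\<K>" using K(3) by blast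
  next
    fix N assume "N \<in> ?\<K>"
    then consider "N = {}" | K1 A where "N = ?f (K1, A)" "K1 \<in> \<K>" "A \<subseteq> g ` \<Sigma>" by auto
    then have "N \<subseteq> lists \<Sigma> \<and> (\<forall>a. deriv a N \<in> ?\<K>)"
    proof cases
      case 1
      then show ?thesis by (simp add: deriv_def)
    next
      case 2
      have "deriv a N \<in> ?\<K>" for a
      proof (cases "a \<in> \<Sigma> \<and> \<not> (p a \<and> g a \<in> A)")
        case True
        let ?A = "if p a then insert (g a) A else A"
        have "deriv a N = ?f (deriv a K1, ?A)"
          using True unfolding 2(1) deriv_def by (auto simp: image_iff)
        moreover have "(deriv a K1, ?A) \<in> \<K> \<times> Pow (g ` \<Sigma>)"
          using 2 K(5) True by auto
        ultimately show ?thesis by (intro insertI2) (rule image_eqI)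
      next
        case False
        then have "deriv a N = {}" using K(4)[OF 2(2)] unfolding 2(1) deriv_def by auto
        then show ?thesis by simp
      qed
      then show ?thesis using K(4)[OF 2(2)] 2(1) by auto
    qed
    then show "N \<subseteq> lists \<Sigma>" "\<And>a. deriv a N \<in> ?\<K>" by auto
  qed (use K in auto)
qed


section \<open>Words of variable bindings\<close>

text \<open>A letter \<open>(x, F, b)\<close> binds \<open>x\<close> to the event being marked and then tests \<open>F\<close>. The flag
  \<open>b\<close> says that the binding belongs to the valuation of the whole expression; it is false
  for the bindings that a \<open>Plus\<close> makes afresh in each iteration after the first.\<close>

type_synonym ('e, 'x) letter = "'x \<times> ('e, 'x) formula \<times> bool"

text \<open>The words below carry, with each letter, the index of the event it marks.\<close>

fun wsat :: "'e evstream \<Rightarrow> nat \<Rightarrow> ('x \<rightharpoonup> nat) \<Rightarrow> (('e, 'x) letter \<times> nat) list \<Rightarrow> bool" where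
  "wsat S i \<mu> [] \<longleftrightarrow> True"
| "wsat S i \<mu> (((x, F, b), k) # w) \<longleftrightarrow>
     i \<le> k \<and> event_at S k \<noteq> None \<and> sat (event_at S \<circ>\<^sub>m \<mu>(x \<mapsto> k)) F \<and>
     wsat S (Suc k) (\<mu>(x \<mapsto> k)) w"

fun wenv :: "('x \<rightharpoonup> nat) \<Rightarrow> (('e, 'x) letter \<times> nat) list \<Rightarrow> ('x \<rightharpoonup> nat)" where
  "wenv \<mu> [] = \<mu>"
| "wenv \<mu> (((x, F, b), k) # w) = wenv (\<mu>(x \<mapsto> k)) w"

text \<open>One past the last marked index. The default \<open>i\<close> on the empty word makes
  \<open>wsat_append\<close> hold without side conditions.\<close>

fun wend :: "nat \<Rightarrow> (('e, 'x) letter \<times> nat) list \<Rightarrow> nat" where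
  "wend i [] = i"
| "wend i ((a, k) # w) = wend (Suc k) w"

text \<open>The counterpart for words of the structural requirement on registers: what a test reads
  has been bound before, or by its own letter.\<close>

fun closed_word :: "'x set \<Rightarrow> ('e, 'x) letter list \<Rightarrow> bool" where
  "closed_word A [] \<longleftrightarrow> True"
| "closed_word A ((x, F, b) # u) \<longleftrightarrow>
     fvars F \<subseteq> insert x A \<and> closed_word (insert x A) u"

definition visible :: "('e, 'x) letter list \<Rightarrow> 'x list" where
  "visible u = map fst (filter (\<lambda>a. snd (snd a)) u)"

text \<open>Hidden bindings do not constrain \<open>v\<close>: they belong to the separate
  valuations of later iterations.\<close>

definition agrees :: "('x \<rightharpoonup> nat) \<Rightarrow> (('e, 'x) letter \<times> nat) list \<Rightarrow> bool" where
  "agrees v w \<longleftrightarrow> (\<forall>x F k. ((x, F, True), k) \<in> set w \<longrightarrow> v x = Some k)"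

definition hide :: "'x set \<Rightarrow> ('e, 'x) letter \<Rightarrow> ('e, 'x) letter" where
  "hide D = (\<lambda>(x, F, b). (x, F, b \<and> x \<notin> D))"

lemma timed_word_induct [case_names Nil Cons]:
  fixes w :: "(('e, 'x) letter \<times> nat) list"
  assumes "Q []" "\<And>x F b k w. Q w \<Longrightarrow> Q (((x, F, b), k) # w)"
  shows "Q w"
  by (induction w) (use assms in auto)

section \<open>Splitting words and changing the initial environment\<close>

lemma sat_cong:
  assumes "\<And>x. x \<in> fvars f \<Longrightarrow> a x = a' x"
  shows "sat a f = sat a' f"
proof -
  have "holds (\<lambda>x. the (a x)) f = holds (\<lambda>x. the (a' x)) f"
    using assms
  proof (induction f)
    case (Atom p xs)
    then have "map (\<lambda>x. the (a x)) xs = map (\<lambda>x. the (a' x)) xs" by simp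
    then show ?case by (simp only: holds.simps)
  qed simp_all
  moreover have "x \<in> dom a \<longleftrightarrow> x \<in> dom a'" if "x \<in> fvars f" for x
    using assms[OF that] by (simp add: domIff)
  ultimately show ?thesis by (simp add: sat_def subset_iff)
qed

lemma sat_Conj: "sat a (Conj f g) \<longleftrightarrow> sat a f \<and> sat a g"
  by (auto simp: sat_def)

lemma wsat_append:
  "wsat S i \<mu> (w @ w') \<longleftrightarrow> wsat S i \<mu> w \<and> wsat S (wend i w) (wenv \<mu> w) w'"
  by (induction w arbitrary: i \<mu> rule: timed_word_induct) auto

lemma closed_word_append:
  "closed_word A (u @ u') \<longleftrightarrow> closed_word A u \<and> closed_word (A \<union> fst ` set u) u'"
  by (induction A u rule: closed_word.induct) auto

lemma closed_word_mono: "closed_word A u \<Longrightarrow> A \<subseteq> B \<Longrightarrow> closed_word B u"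
proof (induction A u arbitrary: B rule: closed_word.induct)
  case (2 A x F b u)
  have "closed_word (insert x B) u" by (rule "2.IH") (use "2.prems" in auto)
  then show ?case using "2.prems" by auto
qed simp

lemma wsat_cong:
  assumes "closed_word A (map fst w)" "\<And>x. x \<in> A \<Longrightarrow> \<mu> x = \<mu>' x"
  shows "wsat S i \<mu> w = wsat S i \<mu>' w"
  using assms
proof (induction w arbitrary: i A \<mu> \<mu>' rule: timed_word_induct)
  case (Cons x F b k w)
  have "wsat S (Suc k) (\<mu>(x \<mapsto> k)) w = wsat S (Suc k) (\<mu>'(x \<mapsto> k)) w"
    using Cons.prems by (intro Cons.IH[of "insert x A"]) auto
  moreover have "sat (event_at S \<circ>\<^sub>m \<mu>(x \<mapsto> k)) F = sat (event_at S \<circ>\<^sub>m \<mu>'(x \<mapsto> k)) F"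
    using Cons.prems by (intro sat_cong) (auto simp: map_comp_def)
  ultimately show ?case by simp
qed simp

text \<open>A closed word binds whatever it tests. Factors can thus be judged from
  \<open>Map.empty\<close> and glued afterwards by \<open>wsat_append\<close>.\<close>

lemma wsat_any_env:
  "closed_word {} (map fst w) \<Longrightarrow> wsat S i \<mu> w = wsat S i Map.empty w"
  by (rule wsat_cong) auto

lemma wsat_bounds:
  "wsat S i \<mu> w \<Longrightarrow> i \<le> wend i w \<and> (\<forall>k \<in> snd ` set w. i \<le> k \<and> k < wend i w)"
proof (induction w arbitrary: i \<mu> rule: timed_word_induct)
  case (Cons x F b k w)
  then have "Suc k \<le> wend (Suc k) w \<and> (\<forall>l \<in> snd ` set w. Suc k \<le> l \<and> l < wend (Suc k) w)"
    by (intro Cons.IH) auto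
  then show ?case using Cons.prems by force
qed simp

text \<open>Identifies \<open>wend\<close> with \<open>Max M + 1\<close>, the index from which the
  semantics starts the next factor.\<close>

lemma wsat_Max:
  "wsat S i \<mu> w \<Longrightarrow> w \<noteq> [] \<Longrightarrow> Suc (Max (snd ` set w)) = wend i w"
proof (induction w arbitrary: i \<mu> rule: timed_word_induct)
  case (Cons x F b k w)
  show ?case
  proof (cases "w = []")
    case False
    have "\<forall>l \<in> snd ` set w. k < l"
      using wsat_bounds[of S "Suc k" _ w] Cons.prems by fastforce
    moreover have "Max (snd ` set w) \<in> snd ` set w" using False by (intro Max_in) simp_all
    ultimately have "k < Max (snd ` set w)" by blast
    moreover have "wsat S (Suc k) (\<mu>(x \<mapsto> k)) w" using Cons.prems(1) by simp
    from Cons.IH[OF this False] have "Suc (Max (snd ` set w)) = wend (Suc k) w" .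
    ultimately show ?thesis using False by simp
  qed simp
qed simp

lemma wsat_weaken: "wsat S i \<mu> w \<Longrightarrow> j \<le> i \<Longrightarrow> wsat S j \<mu> w"
  by (cases "(S, j, \<mu>, w)" rule: wsat.cases) auto

text \<open>The flag \<open>b\<close> is left open here; for the variables of a filter
  \<open>lang_bound\<close> shows that it is true, so that the final environment agrees with the
  valuation.\<close>

lemma wenv_last_binding:
  "y \<in> fst ` fst ` set w \<Longrightarrow> \<exists>F b k. ((y, F, b), k) \<in> set w \<and> wenv \<mu> w y = Some k"
proof (induction w arbitrary: \<mu> rule: timed_word_induct)
  case (Cons x F b k w)
  show ?case
  proof (cases "y \<in> fst ` fst ` set w")
    case True
    from Cons.IH[OF this] obtain G c l
      where "((y, G, c), l) \<in> set w" "wenv (\<mu>(x \<mapsto> k)) w y = Some l" by blast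
    then show ?thesis by (intro exI[of _ G] exI[of _ c] exI[of _ l]) simp
  next
    case False
    have "wenv \<mu>' w y = \<mu>' y" for \<mu>'
      using False by (induction w arbitrary: \<mu>' rule: timed_word_induct) auto
    then show ?thesis using False Cons.prems by auto
  qed
qed simp

section \<open>Visible bindings and valuations\<close>

lemma visible_Nil [simp]: "visible [] = []"
  and visible_Cons [simp]: "visible ((x, F, b) # u) = (if b then x # visible u else visible u)"
  and visible_append [simp]: "visible (u @ u') = visible u @ visible u'"
  by (simp_all add: visible_def)

lemma set_visible: "set (visible u) \<subseteq> fst ` set u"
  by (auto simp: visible_def)

lemma agrees_append [simp]: "agrees v (w @ w') \<longleftrightarrow> agrees v w \<and> agrees v w'"
  by (auto simp: agrees_def)

lemma visible_iff: "x \<in> set (visible (map fst w)) \<longleftrightarrow> (\<exists>F k. ((x, F, True), k) \<in> set w)"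
  by (force simp: visible_def)

text \<open>A variable visible twice would have to be bound to two different indices.\<close>

lemma agrees_distinct:
  "wsat S i \<mu> w \<Longrightarrow> agrees v w \<Longrightarrow> distinct (visible (map fst w))"
proof (induction w arbitrary: i \<mu> rule: timed_word_induct)
  case (Cons x F b k w)
  have v: "agrees v w" "b \<Longrightarrow> v x = Some k" using Cons.prems(2) by (auto simp: agrees_def)
  have "x \<notin> set (visible (map fst w))" if b
  proof
    assume "x \<in> set (visible (map fst w))"
    then obtain G l where l: "((x, G, True), l) \<in> set w" by (auto simp: visible_iff)
    then have "l = k" using v that by (auto simp: agrees_def)
    moreover have "k < l" using wsat_bounds[of S "Suc k" _ w] Cons.prems(1) l by force
    ultimately show False by simp
  qed
  then show ?case using Cons v by auto
qed simp

text \<open>Overrides \<open>v\<close> at each visible variable by the index of its only visible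
  letter. Leaving \<open>v\<close> alone elsewhere matters when the result serves as the valuation
  of a later iteration.\<close>

lemma distinct_agrees:
  "distinct (visible (map fst w)) \<Longrightarrow>
   \<exists>v'. agrees v' w \<and> (\<forall>y. y \<notin> set (visible (map fst w)) \<longrightarrow> v' y = v y)"
proof (induction w)
  case (Cons c w)
  obtain x F b k where c: "c = ((x, F, b), k)" by (metis prod.exhaust)
  obtain v' where v': "agrees v' w" "\<forall>y. y \<notin> set (visible (map fst w)) \<longrightarrow> v' y = v y"
    using Cons by (auto simp: c split: if_splits)
  show ?case
  proof (cases b)
    case True
    then have "x \<notin> set (visible (map fst w))" using Cons.prems c by simp
    then have "agrees (v'(x \<mapsto> k)) (c # w)"
      using v'(1) unfolding visible_iff c agrees_def by auto
    moreover have "\<forall>y. y \<notin> set (visible (map fst (c # w))) \<longrightarrow> (v'(x \<mapsto> k)) y = v y"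
      using v'(2) True by (simp add: c)
    ultimately show ?thesis by blast
  next
    case False
    then show ?thesis using v' by (intro exI[of _ v']) (auto simp: c agrees_def)
  qed
qed (auto simp: agrees_def)

section \<open>Hiding changes flags only, neither indices nor tests\<close>

definition hide_timed where
  "hide_timed D = map (\<lambda>(a, k :: nat). (hide D a, k))"

lemma hide_timed_append [simp]: "hide_timed D (w @ w') = hide_timed D w @ hide_timed D w'"
  by (simp add: hide_timed_def)

lemma map_fst_hide_timed [simp]: "map fst (hide_timed D w) = map (hide D) (map fst w)"
  by (auto simp: hide_timed_def)

lemma map_snd_hide_timed [simp]: "map snd (hide_timed D w) = map snd w"
  by (auto simp: hide_timed_def)

lemma snd_hide_timed [simp]: "snd ` set (hide_timed D w) = snd ` set w"
  by (force simp: hide_timed_def)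

lemma wsat_hide_timed [simp]: "wsat S i \<mu> (hide_timed D w) = wsat S i \<mu> w"
  by (induction w arbitrary: i \<mu> rule: timed_word_induct) (auto simp: hide_timed_def hide_def)

lemma wend_hide_timed [simp]: "wend i (hide_timed D w) = wend i w"
  by (induction w arbitrary: i rule: timed_word_induct) (auto simp: hide_timed_def hide_def)

lemma closed_word_hide [simp]: "closed_word A (map (hide D) u) = closed_word A u"
  by (induction A u rule: closed_word.induct) (auto simp: hide_def)

lemma agrees_hide_timed:
  "agrees v (hide_timed D w) \<longleftrightarrow>
   (\<forall>x F k. ((x, F, True), k) \<in> set w \<and> x \<notin> D \<longrightarrow> v x = Some k)"
  by (force simp: agrees_def hide_timed_def hide_def)

section \<open>The language of an expression\<close>

text \<open>In \<open>Plus\<close> the first factor is not hidden because its valuation is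
  \<open>v\<close> itself; the later ones hide the variables that they may rebind. What remains
  visible refers to the shared \<open>v\<close>, and \<open>distinct\<close> forbids binding it
  twice. With \<open>T\<close> the set of all tuples, the atom for \<open>As\<close> is the type
  predicate that \<open>P\<close> contains.\<close>

primrec lang ::
  "'e set \<Rightarrow> ('e \<Rightarrow> 'r) \<Rightarrow> ('r, 'e, 'x) cepl \<Rightarrow> ('e, 'x) letter list set" where
  "lang T ty (As R x) = {[(x, Atom (1, {[t] | t. t \<in> T \<and> ty t = R}) [x], True)]}"
| "lang T ty (Filter \<psi> f) = map_last (\<lambda>(x, F, b). (x, Conj F f, b)) (lang T ty \<psi>)"
| "lang T ty (Or \<phi>\<^sub>1 \<phi>\<^sub>2) = lang T ty \<phi>\<^sub>1 \<union> lang T ty \<phi>\<^sub>2"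
| "lang T ty (Seq \<phi>\<^sub>1 \<phi>\<^sub>2) = conc (lang T ty \<phi>\<^sub>1) (lang T ty \<phi>\<^sub>2)"
| "lang T ty (Plus \<psi>) =
     {u \<in> conc (lang T ty \<psi>) (star (map (hide (defvars \<psi>)) ` lang T ty \<psi>)).
        distinct (visible u)}"

lemma regular_lang: "regular (lang T ty \<phi>)"
proof (induction \<phi>)
  case (Plus \<psi>)
  then show ?case unfolding lang.simps visible_def
    by (intro regular_distinct regular_conc regular_star regular_map_image)
qed (auto intro: regular_singleton regular_map_last regular_Un regular_conc)

lemma Nil_notin_lang: "[] \<notin> lang T ty \<phi>"
  by (induction \<phi>) (auto simp: conc_def map_last_def)

lemma star_hide_letters:
  "z \<in> star (map (hide D) ` L) \<Longrightarrow> (x, F, b) \<in> set z \<Longrightarrow> \<exists>u \<in> L. \<exists>c. (x, F, c) \<in> set u"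
proof (induction rule: star.induct)
  case (star_append u w)
  then obtain u' where u': "u = map (hide D) u'" "u' \<in> L" by auto
  show ?case
  proof (cases "(x, F, b) \<in> set u")
    case True
    then have "\<exists>c. (x, F, c) \<in> set u'" by (auto simp: u'(1) hide_def)
    then show ?thesis using u'(2) by blast
  next
    case False
    then show ?thesis using star_append by simp
  qed
qed simp

lemma closed_word_any: "closed_word {} u \<Longrightarrow> closed_word A u"
  by (erule closed_word_mono) simp

lemma closed_word_star:
  assumes "\<And>u. u \<in> L \<Longrightarrow> closed_word {} u"
  shows "z \<in> star L \<Longrightarrow> closed_word {} z"
  by (induction rule: star.induct) (auto simp: closed_word_append assms closed_word_any)

lemma lang_vars: "u \<in> lang T ty \<phi> \<Longrightarrow> fst ` set u \<subseteq> cvars \<phi>"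
proof (induction \<phi> arbitrary: u)
  case (Filter \<psi> f)
  then obtain w x F b where w: "u = w @ [(x, Conj F f, b)]" "w @ [(x, F, b)] \<in> lang T ty \<psi>"
    by (auto simp: map_last_def)
  then show ?case using Filter.IH[OF w(2)] by auto
next
  case (Seq \<phi>\<^sub>1 \<phi>\<^sub>2)
  then show ?case by (fastforce simp: conc_def)
next
  case (Plus \<psi>)
  then obtain w z where u: "u = w @ z" "w \<in> lang T ty \<psi>"
    "z \<in> star (map (hide (defvars \<psi>)) ` lang T ty \<psi>)"
    by (auto simp: conc_def)
  have "fst ` set z \<subseteq> cvars \<psi>"
  proof
    fix x assume "x \<in> fst ` set z"
    then obtain F b where "(x, F, b) \<in> set z" by auto
    from star_hide_letters[OF u(3) this] obtain u' c
      where "u' \<in> lang T ty \<psi>" "(x, F, c) \<in> set u'" by blast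
    then show "x \<in> cvars \<psi>" using Plus.IH[of u'] by force
  qed
  then show ?case using Plus.IH[OF u(2)] by (auto simp: u(1))
qed auto

lemma bound_subset_cvars: "bound \<phi> \<subseteq> cvars \<phi>"
  by (induction \<phi>) auto

text \<open>This is what allows a filter to be tested at the last letter: its variables have been
  bound by then, and never by a hidden letter. In \<open>Seq\<close>, disjointness of the variables
  keeps the other factor from rebinding \<open>y\<close>; for \<open>Plus\<close> the set
  \<open>bound\<close> is empty.\<close>

lemma lang_bound:
  assumes "u \<in> lang T ty \<phi>" "bounded \<phi>" "y \<in> bound \<phi>"
  shows "y \<in> fst ` set u \<and> (\<forall>F b. (y, F, b) \<in> set u \<longrightarrow> b)"
  using assms
proof (induction \<phi> arbitrary: u)
  case (Filter \<psi> f)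
  then obtain w x F b where w: "u = w @ [(x, Conj F f, b)]" "w @ [(x, F, b)] \<in> lang T ty \<psi>"
    by (auto simp: map_last_def)
  then show ?case using Filter.IH[OF w(2)] Filter.prems(2,3) by auto
next
  case (Seq \<phi>\<^sub>1 \<phi>\<^sub>2)
  then obtain u1 u2 where u: "u = u1 @ u2" "u1 \<in> lang T ty \<phi>\<^sub>1" "u2 \<in> lang T ty \<phi>\<^sub>2"
    by (auto simp: conc_def)
  note V = lang_vars[OF u(2)] lang_vars[OF u(3)]
  have disj: "cvars \<phi>\<^sub>1 \<inter> cvars \<phi>\<^sub>2 = {}" using Seq.prems by simp
  from Seq.prems(3) consider "y \<in> bound \<phi>\<^sub>1" | "y \<in> bound \<phi>\<^sub>2" by auto
  then show ?case
  proof cases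
    case 1
    then have "y \<notin> fst ` set u2" using bound_subset_cvars[of \<phi>\<^sub>1] disj V(2) by blast
    then show ?thesis using Seq.IH(1)[OF u(2) _ 1] Seq.prems(2) by (force simp: u(1))
  next
    case 2
    then have "y \<notin> fst ` set u1" using bound_subset_cvars[of \<phi>\<^sub>2] disj V(1) by blast
    then show ?thesis using Seq.IH(2)[OF u(3) _ 2] Seq.prems(2) by (force simp: u(1))
  qed
qed auto

text \<open>Beyond the type tests, only filters add tests, and \<open>lang_bound\<close> puts their
  variables among those bound up to the last letter.\<close>

lemma lang_closed: "u \<in> lang T ty \<phi> \<Longrightarrow> bounded \<phi> \<Longrightarrow> closed_word {} u"
proof (induction \<phi> arbitrary: u)
  case (Filter \<psi> f)
  then obtain w x F b where w: "u = w @ [(x, Conj F f, b)]" "w @ [(x, F, b)] \<in> lang T ty \<psi>"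
    by (auto simp: map_last_def)
  have \<psi>: "bounded \<psi>" "fvars f \<subseteq> bound \<psi>" using Filter.prems(2) by simp_all
  have "fvars f \<subseteq> insert x (fst ` set w)"
    using lang_bound[OF w(2) \<psi>(1)] \<psi>(2) by auto
  then show ?case using Filter.IH[OF w(2) \<psi>(1)] by (auto simp: w(1) closed_word_append)
next
  case (Seq \<phi>\<^sub>1 \<phi>\<^sub>2)
  then show ?case by (auto simp: conc_def closed_word_append closed_word_any)
next
  case (Plus \<psi>)
  then obtain w z where u: "u = w @ z" "w \<in> lang T ty \<psi>"
    "z \<in> star (map (hide (defvars \<psi>)) ` lang T ty \<psi>)"
    by (auto simp: conc_def)
  have "closed_word {} z"
    using Plus.IH Plus.prems(2) by (intro closed_word_star[OF _ u(3)]) auto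
  then show ?case using Plus.IH[OF u(2)] Plus.prems(2)
    by (auto simp: u(1) closed_word_append closed_word_any)
qed auto

text \<open>Disjoint variables exclude a repetition in \<open>Seq\<close>, the definition of
  \<open>lang\<close> excludes it in \<open>Plus\<close>. Together with
  \<open>distinct_agrees\<close> this recovers a valuation from a word.\<close>

lemma lang_distinct: "u \<in> lang T ty \<phi> \<Longrightarrow> bounded \<phi> \<Longrightarrow> distinct (visible u)"
proof (induction \<phi> arbitrary: u)
  case (Filter \<psi> f)
  then obtain w x F b where w: "u = w @ [(x, Conj F f, b)]" "w @ [(x, F, b)] \<in> lang T ty \<psi>"
    by (auto simp: map_last_def)
  then show ?case using Filter.IH[OF w(2)] Filter.prems(2) by (auto split: if_splits)
next
  case (Seq \<phi>\<^sub>1 \<phi>\<^sub>2)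
  then obtain u1 u2 where u: "u = u1 @ u2" "u1 \<in> lang T ty \<phi>\<^sub>1" "u2 \<in> lang T ty \<phi>\<^sub>2"
    by (auto simp: conc_def)
  have "set (visible u1) \<inter> set (visible u2) = {}"
    using lang_vars[OF u(2)] lang_vars[OF u(3)] set_visible[of u1] set_visible[of u2]
      Seq.prems(2) by fastforce
  then show ?case using Seq u by simp
qed auto

lemma lang_formula_over:
  assumes "cepl_setting Rel T ty P"
  shows "u \<in> lang T ty \<phi> \<Longrightarrow> cepl_over Rel P \<phi> \<Longrightarrow> (x, F, b) \<in> set u \<Longrightarrow> formula_over P F"
proof (induction \<phi> arbitrary: u x F b)
  case (As R y)
  then show ?case using cepl_setting.pred_type[OF assms] by auto
next
  case (Filter \<psi> f)
  then obtain w y G c where w: "u = w @ [(y, Conj G f, c)]" "w @ [(y, G, c)] \<in> lang T ty \<psi>"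
    by (auto simp: map_last_def)
  have "formula_over P G" using Filter.IH[OF w(2), of y G c] Filter.prems(2) by simp
  moreover have "formula_over P H" if "(z, H, d) \<in> set w" for z H d
    using Filter.IH[OF w(2), of z H d] Filter.prems(2) that by simp
  ultimately show ?case using Filter.prems(2,3) by (auto simp: w(1))
next
  case (Plus \<psi>)
  then obtain w z where u: "u = w @ z" "w \<in> lang T ty \<psi>"
    "z \<in> star (map (hide (defvars \<psi>)) ` lang T ty \<psi>)"
    by (auto simp: conc_def)
  show ?case
  proof (cases "(x, F, b) \<in> set z")
    case True
    from star_hide_letters[OF u(3) this] show ?thesis using Plus.IH Plus.prems(2) by auto
  next
    case False
    then show ?thesis using Plus.IH[OF u(2)] Plus.prems(2,3) by (auto simp: u(1))
  qed
qed (auto simp: conc_def)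


section \<open>Words describe the semantics\<close>

text \<open>The environment starts empty whatever \<open>v\<close> is: tests are fed by the word
  alone, and \<open>v\<close> enters only through \<open>agrees\<close>.\<close>

definition witness where
  "witness T ty \<phi> S i v M w \<longleftrightarrow>
     map fst w \<in> lang T ty \<phi> \<and> wsat S i Map.empty w \<and> agrees v w \<and> M = snd ` set w"

lemma event_at_in_events: "event_at S k = Some t \<Longrightarrow> t \<in> events S"
  by (cases S) (auto split: if_splits)

lemma witness_props:
  assumes "witness T ty \<phi> S i v M w"
  shows "w \<noteq> []" "finite M" "M \<noteq> {}" "Suc (Max M) = wend i w" "\<And>k. k \<in> M \<Longrightarrow> i \<le> k"
proof -
  show w: "w \<noteq> []" using assms Nil_notin_lang[of T ty \<phi>] by (auto simp: witness_def)
  then show "finite M" "M \<noteq> {}" using assms by (auto simp: witness_def)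
  show "Suc (Max M) = wend i w"
    using wsat_Max[of S i Map.empty w] w assms by (simp add: witness_def)
  show "i \<le> k" if "k \<in> M" for k
    using wsat_bounds[of S i Map.empty w] that assms by (auto simp: witness_def)
qed

text \<open>The iterations of a \<open>Plus\<close> after the first.\<close>

inductive iterates for ty S v \<psi> where
  iterates_Nil: "iterates ty S v \<psi> i []"
| iterates_Cons: "M \<in> cepl_sem ty \<psi> S i v' \<Longrightarrow> (\<And>x. x \<notin> defvars \<psi> \<Longrightarrow> v' x = v x) \<Longrightarrow>
    (\<And>k. k \<in> M \<Longrightarrow> i \<le> k) \<Longrightarrow> iterates ty S v \<psi> (Suc (Max M)) Ms \<Longrightarrow>
    iterates ty S v \<psi> i (M # Ms)"

text \<open>Turns the start index \<open>Max M + 1\<close> of the next iteration into the strict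
  separation of \<open>Min\<close> and \<open>Max\<close> that the clause for \<open>Plus\<close>
  asks for.\<close>

lemma cepl_sem_ge: "M \<in> cepl_sem ty \<phi> S i v \<Longrightarrow> k \<in> M \<Longrightarrow> i \<le> k"
proof (induction \<phi> arbitrary: M i v k)
  case (Seq \<phi>\<^sub>1 \<phi>\<^sub>2)
  then obtain M1 M2 where M: "M = M1 \<union> M2" "M1 \<in> cepl_sem ty \<phi>\<^sub>1 S i v"
    "M2 \<in> cepl_sem ty \<phi>\<^sub>2 S (Max M1 + 1) v" by auto
  have "i \<le> Max M1" using Seq.IH(1)[OF M(2)] cepl_sem_finite_nonempty[OF M(2)] Max_in by blast
  then show ?case using Seq.IH(1)[OF M(2), of k] Seq.IH(2)[OF M(3), of k] Seq.prems(2) M(1) by auto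
next
  case (Plus \<psi>)
  then obtain Ms vs where Ms: "M = \<Union>(set Ms)" "Ms ! 0 \<in> cepl_sem ty \<psi> S i v"
    "\<forall>j. 0 < j \<and> j < length Ms \<longrightarrow>
      Ms ! j \<in> cepl_sem ty \<psi> S (Max (Ms ! (j - 1)) + 1) (vs ! j)"
    unfolding cepl_sem.simps mem_Collect_eq by metis
  have "Ms ! j \<noteq> {} \<and> finite (Ms ! j) \<and> (\<forall>k \<in> Ms ! j. i \<le> k)" if "j < length Ms" for j
    using that
  proof (induction j)
    case 0
    then show ?case using Ms(2) Plus.IH cepl_sem_finite_nonempty by blast
  next
    case (Suc j)
    have nxt: "Ms ! Suc j \<in> cepl_sem ty \<psi> S (Max (Ms ! j) + 1) (vs ! Suc j)"
      using Ms(3)[rule_format, of "Suc j"] Suc.prems by simp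
    have "i \<le> Max (Ms ! j)" using Suc by simp
    then show ?case
      using Plus.IH[OF nxt] cepl_sem_finite_nonempty[OF nxt] by fastforce
  qed
  then show ?case using Ms(1) Plus.prems(2) by (metis UnionE in_set_conv_nth)
qed auto

text \<open>Passes between the indexed lists of the semantics and a form suited to rule induction.
  Position 0 has no predecessor and starts at \<open>i\<close>.\<close>

lemma iterates_nth:
  "iterates ty S v \<psi> i Ms \<longleftrightarrow>
   (\<exists>vs. length vs = length Ms \<and> (\<forall>j < length Ms. (\<forall>x. x \<notin> defvars \<psi> \<longrightarrow> (vs ! j) x = v x) \<and>
      Ms ! j \<in> cepl_sem ty \<psi> S (if j = 0 then i else Suc (Max (Ms ! (j - 1)))) (vs ! j)))"
  (is "_ \<longleftrightarrow> ?R i Ms")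
proof (induction Ms arbitrary: i)
  case Nil
  then show ?case by (simp add: iterates_Nil)
next
  case (Cons M Ms)
  have "iterates ty S v \<psi> i (M # Ms) \<longleftrightarrow>
    (\<exists>v'. M \<in> cepl_sem ty \<psi> S i v' \<and> (\<forall>x. x \<notin> defvars \<psi> \<longrightarrow> v' x = v x)) \<and>
    iterates ty S v \<psi> (Suc (Max M)) Ms"
    by (subst iterates.simps) (auto dest: cepl_sem_ge)
  also have "\<dots> \<longleftrightarrow> ?R i (M # Ms)" (is "(\<exists>v'. ?Q v') \<and> _ \<longleftrightarrow> _")
  proof safe
    fix v'
    assume v': "M \<in> cepl_sem ty \<psi> S i v'" "\<forall>x. x \<notin> defvars \<psi> \<longrightarrow> v' x = v x"
      and "iterates ty S v \<psi> (Suc (Max M)) Ms"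
    then obtain vs where vs: "length vs = length Ms"
      "\<forall>j < length Ms. (\<forall>x. x \<notin> defvars \<psi> \<longrightarrow> (vs ! j) x = v x) \<and> Ms ! j \<in> cepl_sem ty \<psi> S
        (if j = 0 then Suc (Max M) else Suc (Max (Ms ! (j - 1)))) (vs ! j)"
      using Cons.IH by blast
    show "?R i (M # Ms)"
    proof (intro exI[of _ "v' # vs"] conjI allI impI)
      fix j assume j: "j < length (M # Ms)"
      show "(M # Ms) ! j \<in> cepl_sem ty \<psi> S
        (if j = 0 then i else Suc (Max ((M # Ms) ! (j - 1)))) ((v' # vs) ! j)"
        using j v'(1) vs by (cases j) (force simp: nth_Cons split: nat.splits)+
      fix x assume "x \<notin> defvars \<psi>"
      then show "((v' # vs) ! j) x = v x"
        using j v'(2) vs by (cases j) auto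
    qed (use vs in simp)
  next
    fix vs
    assume vs: "length vs = length (M # Ms)"
      "\<forall>j < length (M # Ms). (\<forall>x. x \<notin> defvars \<psi> \<longrightarrow> (vs ! j) x = v x) \<and> (M # Ms) ! j \<in>
        cepl_sem ty \<psi> S (if j = 0 then i else Suc (Max ((M # Ms) ! (j - 1)))) (vs ! j)"
    then obtain v' vs' where v': "vs = v' # vs'" "length vs' = length Ms" by (cases vs) auto
    show "\<exists>v'. ?Q v'" using spec[OF vs(2), of 0] v'(1) by auto
    show "iterates ty S v \<psi> (Suc (Max M)) Ms"
    proof (rule Cons.IH[THEN iffD2], intro exI[of _ vs'] conjI allI impI)
      fix j assume "j < length Ms"
      then have j: "(\<forall>x. x \<notin> defvars \<psi> \<longrightarrow> (vs' ! j) x = v x) \<and> Ms ! j \<in>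
        cepl_sem ty \<psi> S (Suc (Max ((M # Ms) ! j))) (vs' ! j)"
        using spec[OF vs(2), of "Suc j"] v' by simp
      then show "Ms ! j \<in> cepl_sem ty \<psi> S
        (if j = 0 then Suc (Max M) else Suc (Max (Ms ! (j - 1)))) (vs' ! j)"
        by (simp add: nth_Cons' split: if_splits)
      fix x assume "x \<notin> defvars \<psi>"
      then show "(vs' ! j) x = v x" using j by simp
    qed (fact v'(2))
  qed
  finally show ?case .
qed

lemma cepl_sem_Plus:
  "M \<in> cepl_sem ty (Plus \<psi>) S i v \<longleftrightarrow>
   (\<exists>M0 Ms. M0 \<in> cepl_sem ty \<psi> S i v \<and> iterates ty S v \<psi> (Suc (Max M0)) Ms \<and>
      M = M0 \<union> \<Union>(set Ms))"
proof
  assume "M \<in> cepl_sem ty (Plus \<psi>) S i v"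
  then obtain Ms vs where Ms: "Ms \<noteq> []" "length vs = length Ms" "M = \<Union>(set Ms)" "vs ! 0 = v"
    "Ms ! 0 \<in> cepl_sem ty \<psi> S i v"
    "\<forall>j. 0 < j \<and> j < length Ms \<longrightarrow>
              (\<forall>x. x \<notin> defvars \<psi> \<longrightarrow> (vs ! j) x = v x) \<and>
              Ms ! j \<in> cepl_sem ty \<psi> S (Max (Ms ! (j - 1)) + 1) (vs ! j)"
    unfolding cepl_sem.simps mem_Collect_eq by metis
  have "(\<forall>x. x \<notin> defvars \<psi> \<longrightarrow> (vs ! j) x = v x) \<and>
      Ms ! j \<in> cepl_sem ty \<psi> S (if j = 0 then i else Suc (Max (Ms ! (j - 1)))) (vs ! j)"
    if "j < length Ms" for j
    using Ms(4,5) Ms(6)[rule_format, of j] that by (cases "j = 0") auto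
  \<comment> \<open>Since \<open>v\<close> agrees with itself, the first iteration also counts as a
    step of \<open>iterates\<close>; rule inversion then splits it off.\<close>
  then have "iterates ty S v \<psi> i Ms" unfolding iterates_nth using Ms(2) by blast
  then obtain M0 Ms' where "Ms = M0 # Ms'" "iterates ty S v \<psi> (Suc (Max M0)) Ms'"
    using Ms(1) by (cases rule: iterates.cases) auto
  then show "\<exists>M0 Ms. M0 \<in> cepl_sem ty \<psi> S i v \<and> iterates ty S v \<psi> (Suc (Max M0)) Ms \<and>
      M = M0 \<union> \<Union>(set Ms)" using Ms(3,5) by auto
next
  assume "\<exists>M0 Ms. M0 \<in> cepl_sem ty \<psi> S i v \<and> iterates ty S v \<psi> (Suc (Max M0)) Ms \<and>
      M = M0 \<union> \<Union>(set Ms)"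
  then obtain M0 Ms where M: "M0 \<in> cepl_sem ty \<psi> S i v" "M = M0 \<union> \<Union>(set Ms)"
    "iterates ty S v \<psi> (Suc (Max M0)) Ms" by blast
  obtain vs where vs: "length vs = length Ms"
    "\<forall>j < length Ms. (\<forall>x. x \<notin> defvars \<psi> \<longrightarrow> (vs ! j) x = v x) \<and> Ms ! j \<in> cepl_sem ty \<psi> S
        (if j = 0 then Suc (Max M0) else Suc (Max (Ms ! (j - 1)))) (vs ! j)"
    using M(3) unfolding iterates_nth by blast
  have later: "(\<forall>x. x \<notin> defvars \<psi> \<longrightarrow> ((v # vs) ! j) x = v x) \<and> (M0 # Ms) ! j \<in>
      cepl_sem ty \<psi> S (Max ((M0 # Ms) ! (j - 1)) + 1) ((v # vs) ! j)"
    if "0 < j \<and> j < length (M0 # Ms)" for j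
    using vs(2)[rule_format, of "j - 1"] that
    by (cases j) (simp_all add: nth_Cons' split: if_splits)
  have gap: "Min ((M0 # Ms) ! j) > Max ((M0 # Ms) ! (j - 1))"
    if "0 < j \<and> j < length (M0 # Ms)" for j
  proof -
    have "finite ((M0 # Ms) ! j)" "(M0 # Ms) ! j \<noteq> {}"
      using later[OF that] cepl_sem_finite_nonempty by blast+
    then show ?thesis using later[OF that] cepl_sem_ge Min_in by fastforce
  qed
  show "M \<in> cepl_sem ty (Plus \<psi>) S i v"
    unfolding cepl_sem.simps mem_Collect_eq
    using M(1,2) vs(1) later gap
    by (intro exI[of _ "M0 # Ms"] exI[of _ "v # vs"] conjI allI impI) auto
qed

text \<open>Each iteration has a witness for its own valuation. Hiding \<open>defvars \<psi>\<close>
  drops the bindings on which that valuation may differ from \<open>v\<close>; those left visible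
  agree with \<open>v\<close>.\<close>

lemma iterates_witness:
  assumes "bounded \<psi>"
    and IH: "\<And>i v M. M \<in> cepl_sem ty \<psi> S i v \<longleftrightarrow> (\<exists>w. witness T ty \<psi> S i v M w)"
    and "iterates ty S v \<psi> i Ms"
  shows "\<exists>w. map fst w \<in> star (map (hide (defvars \<psi>)) ` lang T ty \<psi>) \<and>
    wsat S i Map.empty w \<and> agrees v w \<and> \<Union>(set Ms) = snd ` set w"
  using assms(3)
proof induction
  case (iterates_Nil i)
  then show ?case by (intro exI[of _ "[]"]) (simp add: star_Nil agrees_def)
next
  case (iterates_Cons M i v' Ms)
  let ?D = "defvars \<psi>" and ?L = "map (hide (defvars \<psi>)) ` lang T ty \<psi>"
  obtain w0 where w0: "witness T ty \<psi> S i v' M w0" using iterates_Cons.hyps(1) IH by blast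
  obtain w where w: "map fst w \<in> star ?L" "wsat S (Suc (Max M)) Map.empty w" "agrees v w"
    "\<Union>(set Ms) = snd ` set w" using iterates_Cons.IH by blast
  have closed: "closed_word {} (map fst w)"
    using w(1) lang_closed[OF _ assms(1)] by (intro closed_word_star[OF _ w(1)]) auto
  let ?w = "hide_timed ?D w0 @ w"
  have "map fst ?w \<in> star ?L"
    using w0 star_append[where u = "map (hide ?D) (map fst w0)", OF _ w(1)]
    by (simp add: witness_def del: map_map)
  moreover have "wsat S i Map.empty ?w"
    unfolding wsat_append
  proof
    show "wsat S i Map.empty (hide_timed ?D w0)" using w0 by (simp add: witness_def)
    have "wend i (hide_timed ?D w0) = Suc (Max M)"
      using witness_props(4)[OF w0] by simp
    then show "wsat S (wend i (hide_timed ?D w0)) (wenv Map.empty (hide_timed ?D w0)) w"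
      using w(2) wsat_any_env[OF closed, of S _ "wenv Map.empty (hide_timed ?D w0)"] by simp
  qed
  moreover have "agrees v ?w"
  proof -
    have "v x = Some k" if "((x, F, True), k) \<in> set w0" "x \<notin> ?D" for x F k
      using w0 that iterates_Cons.hyps(2)[OF that(2)] by (auto simp: witness_def agrees_def)
    then show ?thesis using w(3) by (auto simp: agrees_hide_timed)
  qed
  moreover have "\<Union>(set (M # Ms)) = snd ` set ?w"
    using w(4) w0 by (auto simp: witness_def image_Un)
  ultimately show ?case by blast
qed

text \<open>Every factor of the star needs a valuation of its own. \<open>distinct_agrees\<close>
  builds it from \<open>v\<close>, and off \<open>defvars \<psi>\<close> nothing changes, because
  the letters left visible already agree with \<open>v\<close>.\<close>

lemma witness_iterates:
  assumes "bounded \<psi>"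
    and IH: "\<And>i v M. M \<in> cepl_sem ty \<psi> S i v \<longleftrightarrow> (\<exists>w. witness T ty \<psi> S i v M w)"
    and "map fst w \<in> star (map (hide (defvars \<psi>)) ` lang T ty \<psi>)"
    and "wsat S i Map.empty w" "agrees v w"
  shows "\<exists>Ms. iterates ty S v \<psi> i Ms \<and> \<Union>(set Ms) = snd ` set w"
  using assms(3-5)
proof (induction "map fst w" arbitrary: w i rule: star.induct)
  case star_Nil
  then show ?case by (intro exI[of _ "[]"]) (simp add: iterates_Nil)
next
  case (star_append u z)
  let ?D = "defvars \<psi>" and ?L = "map (hide (defvars \<psi>)) ` lang T ty \<psi>"
  obtain u' where u': "u = map (hide ?D) u'" "u' \<in> lang T ty \<psi>" using star_append.hyps(1) by auto
  obtain w1 w2 where w: "w = w1 @ w2" "map fst w1 = map (hide ?D) u'" "map fst w2 = z"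
    using star_append.hyps(4) u'(1) by (metis append_eq_map_conv)
  \<comment> \<open>\<open>hide\<close> loses flags, so the unhidden timed word is rebuilt from the
    original letters \<open>u'\<close> and the indices of \<open>w1\<close>.\<close>
  define w0 where "w0 = zip u' (map snd w1)"
  have len: "length u' = length w1" using w(2) by (metis length_map)
  have fst0: "map fst w0 = u'" using len by (simp add: w0_def)
  have "map snd w0 = map snd w1" using len by (simp add: w0_def)
  then have w1: "hide_timed ?D w0 = w1"
    using w(2) fst0 \<open>map snd w0 = map snd w1\<close> 
    by (intro pair_list_eqI) simp_all
  have "distinct (visible (map fst w0))" using fst0 u'(2) lang_distinct[OF _ assms(1)] by simp
  then obtain v' where v': "agrees v' w0"
    "\<And>y. y \<notin> set (visible (map fst w0)) \<Longrightarrow> v' y = v y"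
    using distinct_agrees[of w0 v] by blast
  have off: "v' y = v y" if "y \<notin> ?D" for y
  proof (cases "y \<in> set (visible (map fst w0))")
    case True
    then obtain F k where k: "((y, F, True), k) \<in> set w0" unfolding visible_iff by blast
    moreover have "agrees v (hide_timed ?D w0)" using star_append.prems(2) w(1) w1 by simp
    ultimately have "v y = Some k" using that by (auto simp: agrees_hide_timed)
    then show ?thesis using k v'(1) by (simp add: agrees_def)
  qed (use v'(2) in simp)
  have sat0: "wsat S i Map.empty (hide_timed ?D w0)"
    using star_append.prems(1) w(1) w1 by (simp add: wsat_append)
  let ?M = "snd ` set w1"
  have wit: "witness T ty \<psi> S i v' ?M w0"
    unfolding witness_def
  proof (intro conjI)
    show "?M = snd ` set w0" using snd_hide_timed[of ?D w0] by (simp only: w1)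
    show "wsat S i Map.empty w0" using sat0 by (simp only: wsat_hide_timed)
  qed (use fst0 u'(2) v'(1) in simp_all)
  have "closed_word {} (map fst w2)"
    unfolding w(3) using lang_closed[OF _ assms(1)]
    by (intro closed_word_star[OF _ star_append.hyps(2)]) auto
  moreover have "w1 \<noteq> []" using w1 witness_props(1)[OF wit] by (auto simp: hide_timed_def)
  then have "wend i w1 = Suc (Max ?M)"
    using wsat_Max[of S i Map.empty w1] sat0 w1 by simp
  ultimately have "wsat S (Suc (Max ?M)) Map.empty w2"
    using star_append.prems(1) w(1) wsat_any_env[of w2 S _ "wenv Map.empty w1"]
    by (simp add: wsat_append)
  then obtain Ms where Ms: "iterates ty S v \<psi> (Suc (Max ?M)) Ms" "\<Union>(set Ms) = snd ` set w2"
    using star_append.hyps(3)[OF w(3)[symmetric]] w(1) star_append.prems(2) by fastforce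
  have "iterates ty S v \<psi> i (?M # Ms)"
    using wit IH off witness_props(5)[OF wit] Ms(1) by (intro iterates_Cons) blast+
  moreover have "\<Union>(set (?M # Ms)) = snd ` set w" using Ms(2) w(1) by (simp add: image_Un)
  ultimately show ?case by blast
qed

text \<open>The valuation has to be kept throughout the induction: in \<open>Seq\<close> and
  \<open>Plus\<close> the same \<open>v\<close> ties the parts together, and the mere existence of a
  valuation for each part would not compose.\<close>

lemma cepl_sem_iff_witness:
  assumes "events S \<subseteq> T"
  shows "bounded \<phi> \<Longrightarrow> M \<in> cepl_sem ty \<phi> S i v \<longleftrightarrow> (\<exists>w. witness T ty \<phi> S i v M w)"
proof (induction \<phi> arbitrary: M i v)
  case (As R x)
  let ?a = "(x, Atom (1, {[t] | t. t \<in> T \<and> ty t = R}) [x], True)"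
  have "witness T ty (As R x) S i v M w \<longleftrightarrow> (\<exists>k t. w = [(?a, k)] \<and> v x = Some k \<and> M = {k} \<and>
      k \<ge> i \<and> event_at S k = Some t \<and> ty t = R)" for w
    using subsetD[OF assms event_at_in_events]
    by (cases w; cases "tl w")
      (auto simp: witness_def agrees_def sat_def map_comp_def split: option.splits)
  then show ?case by auto
next
  case (Filter \<psi> f)
  have \<psi>: "bounded \<psi>" "fvars f \<subseteq> bound \<psi>" using Filter.prems by simp_all
  let ?h = "\<lambda>(x, F, b). (x, Conj F f, b)"
  \<comment> \<open>The word evaluates \<open>f\<close> under its latest bindings, the semantics
    under \<open>v\<close>. On the variables of \<open>f\<close> both coincide because all letters
    binding them are visible.\<close>
  have same: "sat (event_at S \<circ>\<^sub>m wenv Map.empty w) f \<longleftrightarrow> sat (event_at S \<circ>\<^sub>m v) f"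
    if w: "map fst w \<in> lang T ty \<psi>" "agrees v w" for w
  proof (rule sat_cong)
    fix y assume "y \<in> fvars f"
    then have y: "y \<in> bound \<psi>" using \<psi>(2) by blast
    note B = lang_bound[OF w(1) \<psi>(1) y]
    then have "y \<in> fst ` fst ` set w" by simp
    from wenv_last_binding[OF this] obtain F b k
      where k: "((y, F, b), k) \<in> set w" "wenv Map.empty w y = Some k" by blast
    have "(y, F, b) \<in> set (map fst w)" using k(1) by force
    then have b using B by blast
    then have "v y = Some k" using k(1) w(2) by (auto simp: agrees_def)
    then show "(event_at S \<circ>\<^sub>m wenv Map.empty w) y = (event_at S \<circ>\<^sub>m v) y"
      using k(2) by (simp add: map_comp_def)
  qed
  have step: "wsat S i Map.empty (w @ [((x, Conj F f, b), k)]) \<longleftrightarrow>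
      wsat S i Map.empty (w @ [((x, F, b), k)]) \<and>
      sat (event_at S \<circ>\<^sub>m wenv Map.empty (w @ [((x, F, b), k)])) f" for w x F b k
  proof -
    have "wenv \<mu> (w @ [((x, F, b), k)]) = (wenv \<mu> w)(x \<mapsto> k)" for \<mu>
      by (induction w arbitrary: \<mu> rule: timed_word_induct) auto
    then show ?thesis by (auto simp: wsat_append sat_Conj)
  qed
  show ?case
  proof
    assume "M \<in> cepl_sem ty (Filter \<psi> f) S i v"
    then have M: "M \<in> cepl_sem ty \<psi> S i v" "sat (event_at S \<circ>\<^sub>m v) f" by simp_all
    then obtain w where w: "witness T ty \<psi> S i v M w" using Filter.IH[OF \<psi>(1)] by blast
    then obtain w' c where "w = w' @ [c]" using witness_props(1)[OF w] by (metis rev_exhaust)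
    moreover obtain x F b k where "c = ((x, F, b), k)" by (metis prod.exhaust)
    ultimately have w': "w = w' @ [((x, F, b), k)]" by simp
    have "witness T ty (Filter \<psi> f) S i v M (w' @ [((x, Conj F f, b), k)])"
      unfolding witness_def
    proof (intro conjI)
      have "map fst w' @ [(x, F, b)] \<in> lang T ty \<psi>" using w unfolding witness_def w' by simp
      then show "map fst (w' @ [((x, Conj F f, b), k)]) \<in> lang T ty (Filter \<psi> f)"
        by (force simp: map_last_def)
      show "wsat S i Map.empty (w' @ [((x, Conj F f, b), k)])"
        unfolding step using w same[of w] M(2) unfolding witness_def w' by simp
      show "agrees v (w' @ [((x, Conj F f, b), k)])"
        using w unfolding witness_def w' by (auto simp: agrees_def)
    qed (use w in \<open>simp add: witness_def w'\<close>)
    then show "\<exists>w. witness T ty (Filter \<psi> f) S i v M w" by blast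
  next
    assume "\<exists>w. witness T ty (Filter \<psi> f) S i v M w"
    then obtain w where w: "witness T ty (Filter \<psi> f) S i v M w" by blast
    then obtain u x F b where u: "map fst w = u @ [(x, Conj F f, b)]" "u @ [(x, F, b)] \<in> lang T ty \<psi>"
      by (auto simp: witness_def map_last_def)
    then obtain w' k where w': "w = w' @ [((x, Conj F f, b), k)]" "map fst w' = u"
      by (auto simp: map_eq_append_conv)
    let ?w = "w' @ [((x, F, b), k)]"
    have sat: "wsat S i Map.empty ?w" "sat (event_at S \<circ>\<^sub>m wenv Map.empty ?w) f"
      using w unfolding witness_def w'(1) step by simp_all
    have "map fst ?w \<in> lang T ty \<psi>" using u(2) w'(2) by simp
    moreover have agr: "agrees v ?w"
      using w unfolding witness_def w'(1) by (auto simp: agrees_def)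
    moreover have "M = snd ` set ?w" using w by (simp add: witness_def w'(1))
    ultimately show "M \<in> cepl_sem ty (Filter \<psi> f) S i v"
      using sat same[of ?w] Filter.IH[OF \<psi>(1)] unfolding witness_def
      by (auto intro!: exI[of _ ?w])
  qed
next
  case (Or \<phi>\<^sub>1 \<phi>\<^sub>2)
  then show ?case by (auto simp: witness_def)
next
  case (Seq \<phi>\<^sub>1 \<phi>\<^sub>2)
  have bnd: "bounded \<phi>\<^sub>1" "bounded \<phi>\<^sub>2" using Seq.prems by simp_all
  show ?case
  proof
    assume "M \<in> cepl_sem ty (Seq \<phi>\<^sub>1 \<phi>\<^sub>2) S i v"
    then obtain M1 M2 w1 w2 where M: "M = M1 \<union> M2"
      and w1: "witness T ty \<phi>\<^sub>1 S i v M1 w1" and w2: "witness T ty \<phi>\<^sub>2 S (Suc (Max M1)) v M2 w2"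
      using Seq.IH(1)[OF bnd(1)] Seq.IH(2)[OF bnd(2)] by auto
    have "closed_word {} (map fst w2)" using w2 lang_closed[OF _ bnd(2)] by (auto simp: witness_def)
    then have "witness T ty (Seq \<phi>\<^sub>1 \<phi>\<^sub>2) S i v M (w1 @ w2)"
      using w1 w2 M witness_props(4)[OF w1] wsat_any_env[of w2 S "Suc (Max M1)" "wenv Map.empty w1"]
      unfolding witness_def by (auto simp: conc_def wsat_append)
    then show "\<exists>w. witness T ty (Seq \<phi>\<^sub>1 \<phi>\<^sub>2) S i v M w" by blast
  next
    assume "\<exists>w. witness T ty (Seq \<phi>\<^sub>1 \<phi>\<^sub>2) S i v M w"
    then obtain w where w: "witness T ty (Seq \<phi>\<^sub>1 \<phi>\<^sub>2) S i v M w" by blast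
    then obtain u1 u2 where u: "map fst w = u1 @ u2" "u1 \<in> lang T ty \<phi>\<^sub>1" "u2 \<in> lang T ty \<phi>\<^sub>2"
      by (auto simp: witness_def conc_def)
    then obtain w1 w2 where ws: "w = w1 @ w2" "map fst w1 = u1" "map fst w2 = u2"
      by (auto simp: map_eq_append_conv)
    let ?M1 = "snd ` set w1" and ?M2 = "snd ` set w2"
    have w1: "witness T ty \<phi>\<^sub>1 S i v ?M1 w1"
      using w u(2) ws unfolding witness_def by (simp add: wsat_append)
    have "closed_word {} (map fst w2)" using u(3) ws(3) lang_closed[OF _ bnd(2)] by simp
    then have w2: "witness T ty \<phi>\<^sub>2 S (Suc (Max ?M1)) v ?M2 w2"
      using w u(3) ws witness_props(4)[OF w1] wsat_any_env[of w2 S "wend i w1" "wenv Map.empty w1"]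
      unfolding witness_def by (simp add: wsat_append)
    have "Min ?M2 > Max ?M1"
      using witness_props(2,3,5)[OF w2] by (fastforce dest: Min_in)
    moreover have "M = ?M1 \<union> ?M2" using w ws(1) by (simp add: witness_def image_Un)
    ultimately show "M \<in> cepl_sem ty (Seq \<phi>\<^sub>1 \<phi>\<^sub>2) S i v"
      using w1 w2 Seq.IH(1)[OF bnd(1)] Seq.IH(2)[OF bnd(2)] by auto
  qed
next
  case (Plus \<psi>)
  have bnd: "bounded \<psi>" using Plus.prems by simp
  note IH = Plus.IH[OF bnd]
  let ?L = "map (hide (defvars \<psi>)) ` lang T ty \<psi>"
  show ?case
  proof
    assume "M \<in> cepl_sem ty (Plus \<psi>) S i v"
    then obtain M0 Ms where M: "M0 \<in> cepl_sem ty \<psi> S i v"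
      "iterates ty S v \<psi> (Suc (Max M0)) Ms" "M = M0 \<union> \<Union>(set Ms)"
      unfolding cepl_sem_Plus by blast
    obtain w1 where w1: "witness T ty \<psi> S i v M0 w1" using M(1) IH by blast
    obtain w2 where w2: "map fst w2 \<in> star ?L" "wsat S (Suc (Max M0)) Map.empty w2"
      "agrees v w2" "\<Union>(set Ms) = snd ` set w2"
      using iterates_witness[OF bnd IH M(2)] by blast
    have "closed_word {} (map fst w2)"
      using lang_closed[OF _ bnd] by (intro closed_word_star[OF _ w2(1)]) auto
    then have sat: "wsat S i Map.empty (w1 @ w2)"
      using w1 w2(2) witness_props(4)[OF w1] wsat_any_env[of w2 S "Suc (Max M0)" "wenv Map.empty w1"]
      by (simp add: witness_def wsat_append)
    have agr: "agrees v (w1 @ w2)" using w1 w2(3) by (simp add: witness_def)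
    \<comment> \<open>Distinctness holds across the iterations because all visible letters agree
      with one \<open>v\<close> while the indices strictly increase.\<close>
    have "map fst (w1 @ w2) \<in> lang T ty (Plus \<psi>)"
      using w1 w2(1) agrees_distinct[OF sat agr] by (auto simp: witness_def conc_def)
    moreover have "M = snd ` set (w1 @ w2)" using w1 w2(4) M(3) by (auto simp: witness_def)
    ultimately show "\<exists>w. witness T ty (Plus \<psi>) S i v M w"
      using sat agr unfolding witness_def by blast
  next
    assume "\<exists>w. witness T ty (Plus \<psi>) S i v M w"
    then obtain w where w: "witness T ty (Plus \<psi>) S i v M w" by blast
    then obtain u1 u2 where u: "map fst w = u1 @ u2" "u1 \<in> lang T ty \<psi>" "u2 \<in> star ?L"
      by (auto simp: witness_def conc_def)
    then obtain w1 w2 where ws: "w = w1 @ w2" "map fst w1 = u1" "map fst w2 = u2"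
      by (auto simp: map_eq_append_conv)
    let ?M1 = "snd ` set w1" and ?M2 = "snd ` set w2"
    have w1: "witness T ty \<psi> S i v ?M1 w1"
      using w u(2) ws unfolding witness_def by (simp add: wsat_append)
    have "closed_word {} u2" using lang_closed[OF _ bnd] by (intro closed_word_star[OF _ u(3)]) auto
    then have "wsat S (Suc (Max ?M1)) Map.empty w2" "agrees v w2"
      using w ws witness_props(4)[OF w1] wsat_any_env[of w2 S "wend i w1" "wenv Map.empty w1"]
      unfolding witness_def by (simp_all add: wsat_append)
    then obtain Ms where "iterates ty S v \<psi> (Suc (Max ?M1)) Ms" "\<Union>(set Ms) = ?M2"
      using witness_iterates[OF bnd IH] u(3) ws(3) by blast
    moreover have "M = ?M1 \<union> ?M2" using w ws(1) by (simp add: witness_def image_Un)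
    ultimately show "M \<in> cepl_sem ty (Plus \<psi>) S i v"
      unfolding cepl_sem_Plus using w1 IH by blast
  qed
qed

text \<open>Here the valuation disappears: visible variables do not repeat, so some \<open>v\<close>
  fits every word of the language.\<close>

lemma ex_cepl_sem_iff:
  fixes \<phi> :: "('r, 'e, 'x) cepl"
  assumes "events S \<subseteq> T" "bounded \<phi>"
  shows "(\<exists>v. M \<in> cepl_sem ty \<phi> S i v) \<longleftrightarrow>
    (\<exists>w. map fst w \<in> lang T ty \<phi> \<and> wsat S i Map.empty w \<and> M = snd ` set w)"
proof -
  have "\<exists>v. agrees v w" if "map fst w \<in> lang T ty \<phi>" for w :: "(('e, 'x) letter \<times> nat) list"
    using distinct_agrees[OF lang_distinct[OF that assms(2)]] by blast
  then show ?thesis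
    unfolding cepl_sem_iff_witness[OF assms] witness_def by blast
qed


section \<open>The residual automaton\<close>

lemma fvars_map_formula: "fvars (map_formula g F) = g ` fvars F"
  by (induction F) auto

lemma holds_map_formula: "holds a (map_formula g F) = holds (a \<circ> g) F"
  by (induction F) (auto simp: comp_def)

lemma formula_over_map_formula: "formula_over P (map_formula g F) = formula_over P F"
  by (induction F) auto

lemma sat_map_formula: "sat a (map_formula g F) = sat (a \<circ> g) F"
  by (auto simp: sat_def fvars_map_formula holds_map_formula comp_def)

lemma finite_fvars: "finite (fvars F)"
  by (induction F) auto

text \<open>\<open>formula_ok\<close> requires the variables to be exactly the positions of the
  register selection; a list without repetitions gives the bijection for the renaming.\<close>

definition var_list :: "('e, 'x) formula \<Rightarrow> 'x list" where
  "var_list F = (SOME ys. set ys = fvars F \<and> distinct ys)"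

lemma var_list: "set (var_list F) = fvars F" "distinct (var_list F)"
  using someI_ex[OF finite_distinct_list[OF finite_fvars[of F]]] by (simp_all add: var_list_def)

definition var_pos :: "('e, 'x) formula \<Rightarrow> 'x \<Rightarrow> nat" where
  "var_pos F = the_inv_into {..<length (var_list F)} (\<lambda>k. var_list F ! k)"

lemma var_pos_bij: "bij_betw (var_pos F) (fvars F) {..<length (var_list F)}"
  unfolding var_pos_def using bij_betw_nth[OF var_list(2) refl refl, of F] var_list(1)[of F]
  by (simp add: bij_betw_the_inv_into)

lemma var_list_var_pos:
  assumes "y \<in> fvars F"
  shows "var_pos F y < length (var_list F)" "var_list F ! var_pos F y = y"
proof -
  show "var_pos F y < length (var_list F)" 
    using bij_betwE[OF var_pos_bij[of F]] assms by blast
  show "var_list F ! var_pos F y = y" unfolding var_pos_def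
    using bij_betw_nth[OF var_list(2) refl refl, of F] var_list(1)[of F] assms
    by (intro f_the_inv_into_f_bij_betw) auto
qed

lemma regular_finite:
  assumes "regular L"
  shows "finite (range (\<lambda>u. derivs u L))" "finite (\<Union>u \<in> L. set u)"
proof -
  from assms obtain \<K> \<Sigma> where K: "finite \<K>" "finite \<Sigma>" "L \<in> \<K>"
    "\<And>K. K \<in> \<K> \<Longrightarrow> K \<subseteq> lists \<Sigma>" "\<And>K a. K \<in> \<K> \<Longrightarrow> deriv a K \<in> \<K>"
    by (rule regularE) blast
  have "derivs u K \<in> \<K>" if "K \<in> \<K>" for u K
    using that by (induction u arbitrary: K) (simp_all add: K(5))
  then have "range (\<lambda>u. derivs u L) \<subseteq> \<K>" using K(3) by auto
  then show "finite (range (\<lambda>u. derivs u L))" using K(1) finite_subset by blast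
  have "(\<Union>u \<in> L. set u) \<subseteq> \<Sigma>" using K(4)[OF K(3)] by auto
  then show "finite (\<Union>u \<in> L. set u)" using K(2) finite_subset by blast
qed

lemma regular_finite_vars:
  assumes "regular L"
  shows "finite (\<Union>u \<in> L. \<Union>(x, F, b) \<in> set u. insert x (fvars F))"
proof -
  have "(\<Union>u \<in> L. \<Union>(x, F, b) \<in> set u. insert x (fvars F)) =
      (\<Union>(x, F, b) \<in> \<Union>u \<in> L. set u. insert x (fvars F))"
    by blast
  moreover have "finite (\<Union>(x, F, b) \<in> \<Union>u \<in> L. set u. insert x (fvars F))"
    by (rule finite_UN_I[OF regular_finite(2)[OF assms]]) (simp add: split_beta finite_fvars)
  ultimately show ?thesis by simp
qed

text \<open>\<open>enc\<close> and \<open>reg\<close> code residuals and variables by numbers.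
  Injectivity is asked only on the finitely many that occur, as the types may be too large for a
  global coding.\<close>

locale residual_automaton =
  fixes T :: "'e set" and P :: "'e evpred set"
    and L :: "('e, 'x) letter list set" and enc :: "('e, 'x) letter list set \<Rightarrow> nat"
    and reg :: "'x \<Rightarrow> nat"
  assumes TRUE_pred: "(1, {[t] | t. t \<in> T}) \<in> P"
    and over: "u \<in> L \<Longrightarrow> (x, F, b) \<in> set u \<Longrightarrow> formula_over P F"
    and closed: "u \<in> L \<Longrightarrow> closed_word {} u"
    and no_Nil: "[] \<notin> L"
    and regular: "regular L"
    and inj_enc: "inj_on enc (range (\<lambda>u. derivs u L))"
    and inj_reg: "inj_on reg (\<Union>u \<in> L. \<Union>(x, F, b) \<in> set u. insert x (fvars F))"
begin

abbreviation residuals :: "('e, 'x) letter list set set" where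
  "residuals \<equiv> range (\<lambda>u. derivs u L)"

abbreviation letters :: "('e, 'x) letter set" where
  "letters \<equiv> \<Union>u \<in> L. set u"

definition vars :: "'x set" where
  "vars = (\<Union>u \<in> L. \<Union>(x, F, b) \<in> set u. insert x (fvars F))"

definition skip :: "nat \<Rightarrow> ('e, nat, nat) transition" where
  "skip q = Trans q (Atom (1, {[t] | t. t \<in> T}) [0]) [Cur] q {} Skip"

text \<open>\<open>F\<close> is tested with \<open>x\<close> already bound, while the register of
  \<open>x\<close> is written only by this very step; hence \<open>x\<close> is read from
  \<open>Cur\<close> and every other variable from its register.\<close>

fun mark :: "nat \<Rightarrow> ('e, 'x) letter \<Rightarrow> nat \<Rightarrow> ('e, nat, nat) transition" where
  "mark q (x, F, b) p = Trans q (map_formula (var_pos F) F)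
     (map (\<lambda>y. if y = x then Cur else Reg (reg y)) (var_list F)) p {reg x} Mark"

declare mark.simps [simp del]

text \<open>Marking transitions into the empty residual are left out. Every transition then
  continues to a word of \<open>L\<close>, so that closedness of these words yields the condition that
  the registers read have been written on every path.\<close>

definition aut :: "('e, nat, nat) rma" where
  "aut = \<lparr>states = enc ` residuals, starts = {enc L}, finals = enc ` {K \<in> residuals. [] \<in> K},
     registers = reg ` vars,
     transitions = skip ` enc ` residuals \<union>
       {mark (enc K) a (enc (deriv a K)) | K a. K \<in> residuals \<and> deriv a K \<noteq> {}}\<rparr>"

lemma aut_simps [simp]:
  "states aut = enc ` residuals" "starts aut = {enc L}"
  "finals aut = enc ` {K \<in> residuals. [] \<in> K}" "registers aut = reg ` vars"
  by (simp_all add: aut_def)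

lemma transitions_cases:
  assumes "d \<in> transitions aut"
  obtains (skip) K where "K \<in> residuals" "d = skip (enc K)"
  | (mark) K x F b where "K \<in> residuals" "deriv (x, F, b) K \<noteq> {}"
      "d = mark (enc K) (x, F, b) (enc (deriv (x, F, b) K))"
proof -
  from assms consider "d \<in> skip ` enc ` residuals"
    | "d \<in> {mark (enc K) a (enc (deriv a K)) | K a. K \<in> residuals \<and> deriv a K \<noteq> {}}"
    unfolding aut_def rma.simps Un_iff by blast
  then show thesis
  proof cases
    case 1
    then show ?thesis using skip by blast
  next
    case 2
    then obtain K a where "K \<in> residuals" "deriv a K \<noteq> {}"
      "d = mark (enc K) a (enc (deriv a K))" by blast
    then show ?thesis using mark by (cases a) blast
  qed
qed

lemma L_residual: "L \<in> residuals"
  by (rule range_eqI[of _ _ "[]"]) simp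

lemma deriv_residual: "K \<in> residuals \<Longrightarrow> deriv a K \<in> residuals"
proof -
  assume "K \<in> residuals"
  then obtain u where "K = derivs u L" by blast
  then have "deriv a K = derivs (u @ [a]) L" by (simp add: deriv_def derivs_def)
  then show ?thesis by blast
qed

lemma residual_letter:
  assumes "K \<in> residuals" "deriv a K \<noteq> {}"
  obtains u z where "K = derivs u L" "u @ a # z \<in> L"
  using assms by (auto simp: deriv_def derivs_def)

lemma letter_vars:
  assumes "K \<in> residuals" "deriv (x, F, b) K \<noteq> {}"
  shows "insert x (fvars F) \<subseteq> vars" "formula_over P F"
proof -
  obtain u z where u: "u @ (x, F, b) # z \<in> L" using residual_letter[OF assms] .
  then have "(x, F, b) \<in> set (u @ (x, F, b) # z)" by simp
  then show "insert x (fvars F) \<subseteq> vars" "formula_over P F"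
    using u over unfolding vars_def by blast+
qed

lemma src_tgt [simp]: "src (skip q) = q" "tgt (skip q) = q"
  "src (mark q a p) = q" "tgt (mark q a p) = p"
  by (simp_all add: skip_def, (cases a, simp add: mark.simps)+)

lemma reads_skip [simp]: "reads (skip q) = {}" "writes (skip q) = {}"
  by (simp_all add: skip_def)

lemma reads_mark [simp]: "reads (mark q (x, F, b) p) = reg ` (fvars F - {x})"
  by (auto simp: mark.simps var_list(1) split: if_splits)

lemma writes_mark [simp]: "writes (mark q (x, F, b) p) = {reg x}"
  by (simp add: mark.simps)

lemma output_of_simps [simp]: "output_of (skip q) = Some Skip" "output_of (mark q a p) = Some Mark"
  by (simp_all add: skip_def, cases a, simp add: mark.simps)

lemma finite_transitions: "finite (transitions aut)"
proof -
  have "{mark (enc K) a (enc (deriv a K)) | K a. K \<in> residuals \<and> deriv a K \<noteq> {}} \<subseteq>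
    (\<lambda>(K, a). mark (enc K) a (enc (deriv a K))) ` (residuals \<times> letters)"
  proof
    fix d assume "d \<in> {mark (enc K) a (enc (deriv a K)) | K a. K \<in> residuals \<and> deriv a K \<noteq> {}}"
    then obtain K a where K: "K \<in> residuals" "deriv a K \<noteq> {}"
      "d = mark (enc K) a (enc (deriv a K))" by blast
    obtain u z where "u @ a # z \<in> L" using residual_letter[OF K(1,2)] .
    then have "a \<in> letters" by (rule UN_I) simp
    then show "d \<in> (\<lambda>(K, a). mark (enc K) a (enc (deriv a K))) ` (residuals \<times> letters)"
      using K by (intro image_eqI[of _ _ "(K, a)"]) auto
  qed
  then show ?thesis
    using regular_finite[OF regular] unfolding aut_def rma.simps
    by (intro finite_UnI) (auto dest: finite_subset)
qed

text \<open>The marking transitions of a path spell \<open>u\<close>, and skips leave the residual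
  unchanged. Injectivity of \<open>enc\<close> lets the source state determine the residual. All
  paths are covered, hence all trails.\<close>

lemma path_writes:
  assumes "path aut (enc K) ds q" "K \<in> residuals"
  shows "\<exists>u. q = enc (derivs u K) \<and> (\<forall>x \<in> fst ` set u. \<exists>d \<in> set ds. reg x \<in> writes d)"
  using assms
proof (induction ds arbitrary: K)
  case Nil
  then show ?case by (intro exI[of _ "[]"]) simp
next
  case (Cons d ds)
  then have d: "d \<in> transitions aut" "src d = enc K" "path aut (tgt d) ds q" by simp_all
  from d(1) show ?case
  proof (cases rule: transitions_cases)
    case (skip K')
    then have "tgt d = enc K" using d(2) by simp
    then show ?thesis using Cons.IH[of K] d(3) Cons.prems(2) by fastforce
  next
    case (mark K' x F b)
    then have "K' = K" using d(2) inj_onD[OF inj_enc] Cons.prems(2) by simp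
    then have "path aut (enc (deriv (x, F, b) K)) ds q" using d(3) mark(3) by simp
    from Cons.IH[OF this deriv_residual[OF Cons.prems(2)]] obtain u
      where u: "q = enc (derivs u (deriv (x, F, b) K))"
        "\<forall>x \<in> fst ` set u. \<exists>d \<in> set ds. reg x \<in> writes d" by blast
    have "reg x \<in> writes d" using mark(3) by simp
    then show ?thesis using u by (intro exI[of _ "(x, F, b) # u"]) simp
  qed
qed

lemma is_rma_aut: "is_rma P aut"
proof -
  note fin = regular_finite[OF regular]
  have "finite vars" unfolding vars_def by (rule regular_finite_vars[OF regular])
  moreover have "src d \<in> states aut \<and> tgt d \<in> states aut \<and> formula_ok P d \<and>
      reads d \<subseteq> registers aut \<and> writes d \<subseteq> registers aut" if "d \<in> transitions aut" for d
    using that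
  proof (cases rule: transitions_cases)
    case (skip K)
    have "formula_ok P (skip q)" for q using TRUE_pred by (auto simp: skip_def)
    then show ?thesis using skip by simp
  next
    case (mark K x F b)
    note V = letter_vars[OF mark(1,2)]
    have "formula_ok P d"
      using V(2) mark(3) bij_betw_imp_surj_on[OF var_pos_bij[of F]]
      by (simp add: mark.simps formula_over_map_formula fvars_map_formula)
    moreover have "reads d \<subseteq> reg ` vars"
      unfolding mark(3) reads_mark by (rule image_mono[OF order_trans[OF _ V(1)]]) blast
    moreover have "writes d \<subseteq> reg ` vars"
      unfolding mark(3) writes_mark using V(1) by simp
    ultimately show ?thesis using mark deriv_residual[OF mark(1)] by simp
  qed
  moreover have "\<exists>d' \<in> set ds. r \<in> writes d'"
    if d: "d \<in> transitions aut" "r \<in> reads d" "trail_to aut ds (src d)" for d r ds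
    using d(1)
  proof (cases rule: transitions_cases)
    case (skip K)
    then show ?thesis using d(2) by simp
  next
    case (mark K x F b)
    have "path aut (enc L) ds (enc K)" using d(3) mark(3) by (auto simp: trail_to_def)
    from path_writes[OF this L_residual] obtain u
      where u: "enc K = enc (derivs u L)" "\<forall>x \<in> fst ` set u. \<exists>d \<in> set ds. reg x \<in> writes d" by blast
    \<comment> \<open>The marking transition exists only because \<open>deriv (x, F, b) K\<close> is
      nonempty. So the word spelled by the path extends to one of \<open>L\<close>, whose closedness
      puts the variables of \<open>F\<close> other than \<open>x\<close> among those
      written.\<close>
    have "K = derivs u L" using inj_onD[OF inj_enc u(1) mark(1)] by blast
    with mark(2) obtain z where "u @ (x, F, b) # z \<in> L" by (auto simp: deriv_def derivs_def)
    from closed[OF this] have "fvars F \<subseteq> insert x (fst ` set u)"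
      by (simp add: closed_word_append)
    then have "fvars F - {x} \<subseteq> fst ` set u" by blast
    then show ?thesis using d(2) u(2) unfolding mark(3) reads_mark by blast
  qed
  ultimately show ?thesis
    using fin(1) L_residual finite_transitions unfolding is_rma_def by auto
qed

section \<open>Correspondence between runs and satisfied words\<close>

lemma mark_applicable:
  assumes "event_at S i = Some t" "\<And>y. y \<in> fvars F \<Longrightarrow> \<gamma> (reg y) = (event_at S \<circ>\<^sub>m \<mu>) y"
  shows "succ_config S (i, q, \<gamma>) (mark q (x, F, b) p) c' \<longleftrightarrow>
    sat (event_at S \<circ>\<^sub>m \<mu>(x \<mapsto> i)) F \<and> c' = (Suc i, p, \<gamma>(reg x \<mapsto> t))"
proof -
  let ?rs = "map (\<lambda>y. if y = x then Cur else Reg (reg y)) (var_list F)"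
  let ?a = "\<lambda>k. if k < length ?rs then content \<gamma> t (?rs ! k) else None"
  \<comment> \<open>\<open>Cur\<close> supplies the new value of \<open>x\<close> and the registers
    the old values of the other variables, which together are the updated environment.\<close>
  have "sat ?a (map_formula (var_pos F) F) = sat (event_at S \<circ>\<^sub>m \<mu>(x \<mapsto> i)) F"
    unfolding sat_map_formula
  proof (rule sat_cong)
    fix y assume y: "y \<in> fvars F"
    then show "(?a \<circ> var_pos F) y = (event_at S \<circ>\<^sub>m \<mu>(x \<mapsto> i)) y"
      using var_list_var_pos[OF y] assms(2)[OF y] assms(1) by (simp add: map_comp_def)
  qed
  then show ?thesis using assms(1) 
    by (cases c') (auto simp: mark.simps fun_upd_def)
qed

lemma skip_applicable:
  assumes "events S \<subseteq> T"
  shows "succ_config S (i, q, \<gamma>) (skip q) c' \<longleftrightarrow> event_at S i \<noteq> None \<and> c' = (Suc i, q, \<gamma>)"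
proof -
  have "t \<in> T" if "event_at S i = Some t" for t
    using that assms by (cases S) (auto split: if_splits)
  then show ?thesis by (cases c') (auto simp: skip_def sat_def)
qed

text \<open>The invariant of both simulations; an empty register stands for an unbound variable. It
  is limited to \<open>vars\<close>, where \<open>reg\<close> is injective and an update cannot
  disturb another variable.\<close>

definition linked :: "'e evstream \<Rightarrow> (nat \<rightharpoonup> 'e) \<Rightarrow> ('x \<rightharpoonup> nat) \<Rightarrow> bool" where
  "linked S \<gamma> \<mu> \<longleftrightarrow> (\<forall>y \<in> vars. \<gamma> (reg y) = (event_at S \<circ>\<^sub>m \<mu>) y)"

lemma linked_upd:
  assumes "linked S \<gamma> \<mu>" "x \<in> vars" "event_at S k = Some t"
  shows "linked S (\<gamma>(reg x \<mapsto> t)) (\<mu>(x \<mapsto> k))"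
  unfolding linked_def
proof
  fix y assume y: "y \<in> vars"
  show "(\<gamma>(reg x \<mapsto> t)) (reg y) = (event_at S \<circ>\<^sub>m \<mu>(x \<mapsto> k)) y"
  proof (cases "y = x")
    case True
    then show ?thesis using assms(3) by (simp add: map_comp_def)
  next
    case False
    then have "reg y \<noteq> reg x" using inj_onD[OF inj_reg[folded vars_def] _ y assms(2)] by blast
    moreover have "\<gamma> (reg y) = (event_at S \<circ>\<^sub>m \<mu>) y"
      using assms(1) y unfolding linked_def by blast
    ultimately show ?thesis using False by (simp add: map_comp_def)
  qed
qed

lemma match_of_Cons:
  "match_of (c, (d, c') # st) =
     (if output_of d = Some Mark then {fst c} else {}) \<union> match_of (c', st)"
proof -
  have "match_of (c, (d, c') # st) =
    (\<lambda>k. fst ((c # c' # map snd st) ! k)) `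
      {k. k < Suc (length st) \<and> output_of (fst (((d, c') # st) ! k)) = Some Mark}"
    by (auto simp: match_of_def)
  also have "{k. k < Suc (length st) \<and> output_of (fst (((d, c') # st) ! k)) = Some Mark} =
    (if output_of d = Some Mark then {0} else {}) \<union>
    Suc ` {k. k < length st \<and> output_of (fst (st ! k)) = Some Mark}" (is "?A = ?B")
  proof (rule set_eqI)
    show "k \<in> ?A \<longleftrightarrow> k \<in> ?B" for k by (cases k) auto
  qed
  finally show ?thesis by (auto simp: match_of_def image_Un image_image)
qed

lemma match_of_Nil: "match_of (c, []) = {}"
  by (simp add: match_of_def)

definition last_state where
  "last_state c st = fst (snd (last (configs (c, st))))"

lemma last_state_simps [simp]:
  "last_state (i, q, \<gamma>) [] = q" "last_state c ((d, c') # st) = last_state c' st"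
  by (simp_all add: last_state_def)

lemma run_outputs_Cons:
  "run_outputs (c, (d, c') # st) =
     (case output_of d of None \<Rightarrow> [] | Some out \<Rightarrow> [out]) @ run_outputs (c', st)"
  by (simp add: run_outputs_def map_filter_def split: option.splits)

text \<open>A marking step contributes its letter with the current index. A skip contributes
  nothing; the delay it causes is absorbed by \<open>wsat_weaken\<close>.\<close>

lemma steps_word:
  assumes "events S \<subseteq> T"
  shows "steps_from aut S (i, enc K, \<gamma>) st \<Longrightarrow> K \<in> residuals \<Longrightarrow> linked S \<gamma> \<mu> \<Longrightarrow>
    \<exists>w. wsat S i \<mu> w \<and> last_state (i, enc K, \<gamma>) st = enc (derivs (map fst w) K) \<and>
      derivs (map fst w) K \<in> residuals \<and> match_of ((i, enc K, \<gamma>), st) = snd ` set w"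
proof (induction st arbitrary: i K \<gamma> \<mu>)
  case Nil
  then show ?case by (intro exI[of _ "[]"]) (simp add: match_of_Nil)
next
  case (Cons s st)
  obtain d c' where s: "s = (d, c')" by (cases s)
  have d: "d \<in> transitions aut" "succ_config S (i, enc K, \<gamma>) d c'" "steps_from aut S c' st"
    using Cons.prems(1) by (simp_all add: s)
  have src: "src d = enc K" using d(2) by (cases d; cases c') auto
  from d(1) show ?case
  proof (cases rule: transitions_cases)
    case (skip K')
    then have dK: "d = skip (enc K)" using src by simp
    have c': "c' = (Suc i, enc K, \<gamma>)" using d(2) unfolding dK skip_applicable[OF assms] by blast
    from Cons.IH[OF d(3)[unfolded c'] Cons.prems(2,3)] obtain w
      where w: "wsat S (Suc i) \<mu> w" "last_state (Suc i, enc K, \<gamma>) st = enc (derivs (map fst w) K)"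
        "derivs (map fst w) K \<in> residuals" "match_of ((Suc i, enc K, \<gamma>), st) = snd ` set w" by blast
    have "wsat S i \<mu> w" using wsat_weaken[OF w(1)] by simp
    then show ?thesis using w by (intro exI[of _ w]) (simp add: s c' match_of_Cons dK)
  next
    case (mark K' x F b)
    then have K': "K' = K" using src inj_onD[OF inj_enc] Cons.prems(2) by simp
    let ?a = "(x, F, b)" and ?K = "deriv (x, F, b) K"
    have dK: "d = mark (enc K) ?a (enc ?K)" using mark(3) K' by simp
    have V: "x \<in> vars" "fvars F \<subseteq> vars" using letter_vars[OF mark(1,2)] by simp_all
    obtain t where t: "event_at S i = Some t" using d(2) unfolding dK by (cases c') (auto simp: mark.simps)
    have "\<gamma> (reg y) = (event_at S \<circ>\<^sub>m \<mu>) y" if "y \<in> fvars F" for y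
      using Cons.prems(3) V(2) that unfolding linked_def by blast
    from mark_applicable[OF t this] d(2)[unfolded dK]
    have sat: "sat (event_at S \<circ>\<^sub>m \<mu>(x \<mapsto> i)) F" and c': "c' = (Suc i, enc ?K, \<gamma>(reg x \<mapsto> t))"
      by blast+
    from Cons.IH[OF d(3)[unfolded c'] deriv_residual[OF Cons.prems(2)]
        linked_upd[OF Cons.prems(3) V(1) t]] obtain w
      where w: "wsat S (Suc i) (\<mu>(x \<mapsto> i)) w"
        "last_state (Suc i, enc ?K, \<gamma>(reg x \<mapsto> t)) st = enc (derivs (map fst w) ?K)"
        "derivs (map fst w) ?K \<in> residuals"
        "match_of ((Suc i, enc ?K, \<gamma>(reg x \<mapsto> t)), st) = snd ` set w" by blast
    have "wsat S i \<mu> ((?a, i) # w)" using w(1) sat t by simp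
    moreover have "output_of d = Some Mark" by (simp add: dK)
    ultimately show ?thesis using w
      by (intro exI[of _ "(?a, i) # w"]) (simp add: s c' match_of_Cons)
  qed
qed

lemma event_at_downward: "event_at S k \<noteq> None \<Longrightarrow> i \<le> k \<Longrightarrow> event_at S i \<noteq> None"
  by (cases S) (auto split: if_splits)

lemma skip_transition: "K \<in> residuals \<Longrightarrow> skip (enc K) \<in> transitions aut"
  by (simp add: aut_def)

lemma mark_transition:
  "K \<in> residuals \<Longrightarrow> deriv a K \<noteq> {} \<Longrightarrow> mark (enc K) a (enc (deriv a K)) \<in> transitions aut"
  unfolding aut_def rma.simps by blast

text \<open>Demanding a nonempty list of outputs allows steps to be put in front without changing
  the last output.\<close>

definition good_run where
  "good_run S c q M st \<longleftrightarrow> steps_from aut S c st \<and> last_state c st = q \<and>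
     match_of (c, st) = M \<and> run_outputs (c, st) \<noteq> [] \<and> last (run_outputs (c, st)) = Mark"

text \<open>Puts skip loops in front, backwards from \<open>k\<close> to \<open>i\<close>; a stream
  with an event at \<open>k\<close> has one at every earlier index.\<close>

lemma good_run_skips:
  assumes "events S \<subseteq> T" "K \<in> residuals"
    and "event_at S k \<noteq> None" "i \<le> k" "good_run S (k, enc K, \<gamma>) q M st"
  shows "\<exists>st'. good_run S (i, enc K, \<gamma>) q M st'"
  using assms(4)
proof (induction rule: inc_induct)
  case base
  then show ?case using assms(5) by blast
next
  case (step i)
  then obtain st' where st': "good_run S (Suc i, enc K, \<gamma>) q M st'" by blast
  have "event_at S i \<noteq> None" using event_at_downward[OF assms(3)] step.hyps by simp
  then have "good_run S (i, enc K, \<gamma>) q M ((skip (enc K), (Suc i, enc K, \<gamma>)) # st')"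
    using st' skip_transition[OF assms(2)] skip_applicable[OF assms(1)]
    by (simp add: good_run_def match_of_Cons run_outputs_Cons)
  then show ?case by blast
qed

text \<open>The run waits in skip loops for each index and stops right after the last mark. A
  nonempty word is needed for its last output to be \<open>Mark\<close>.\<close>

lemma word_steps:
  assumes "events S \<subseteq> T"
  shows "wsat S i \<mu> w \<Longrightarrow> w \<noteq> [] \<Longrightarrow> map fst w \<in> K \<Longrightarrow> K \<in> residuals \<Longrightarrow> linked S \<gamma> \<mu> \<Longrightarrow>
    \<exists>st. good_run S (i, enc K, \<gamma>) (enc (derivs (map fst w) K)) (snd ` set w) st"
proof (induction w arbitrary: i K \<gamma> \<mu> rule: timed_word_induct)
  case (Cons x F b k w)
  let ?a = "(x, F, b)" and ?K = "deriv (x, F, b) K"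
  have tail: "map fst w \<in> ?K" using Cons.prems(3) by (simp add: deriv_def)
  then have ne: "?K \<noteq> {}" by blast
  have V: "x \<in> vars" "fvars F \<subseteq> vars" using letter_vars[OF Cons.prems(4) ne] by simp_all
  obtain t where t: "event_at S k = Some t" using Cons.prems(1) by auto
  have sat: "sat (event_at S \<circ>\<^sub>m \<mu>(x \<mapsto> k)) F" "wsat S (Suc k) (\<mu>(x \<mapsto> k)) w" "i \<le> k"
    using Cons.prems(1) by simp_all
  let ?c = "(Suc k, enc ?K, \<gamma>(reg x \<mapsto> t))" and ?d = "mark (enc K) ?a (enc ?K)"
  have "\<gamma> (reg y) = (event_at S \<circ>\<^sub>m \<mu>) y" if "y \<in> fvars F" for y
    using Cons.prems(5) V(2) that unfolding linked_def by blast
  then have step: "succ_config S (k, enc K, \<gamma>) ?d ?c" "?d \<in> transitions aut"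
    using mark_applicable[OF t] sat(1) mark_transition[OF Cons.prems(4) ne] by blast+
  have "\<exists>st. good_run S (k, enc K, \<gamma>) (enc (derivs (map fst w) ?K))
    (insert k (snd ` set w)) ((?d, ?c) # st)"
  proof (cases "w = []")
    case True
    have "run_outputs (?c, []) = []" by (simp add: run_outputs_def map_filter_def)
    then show ?thesis using True step
      by (intro exI[of _ "[]"])
        (simp add: good_run_def match_of_Cons match_of_Nil run_outputs_Cons)
  next
    case False
    from Cons.IH[OF sat(2) False tail deriv_residual[OF Cons.prems(4)]
        linked_upd[OF Cons.prems(5) V(1) t]] obtain st
      where "good_run S ?c (enc (derivs (map fst w) ?K)) (snd ` set w) st" by blast
    then show ?thesis using step
      by (intro exI[of _ st])
        (simp add: good_run_def match_of_Cons run_outputs_Cons)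
  qed
  then show ?case
    using good_run_skips[OF assms Cons.prems(4) _ sat(3)] t by fastforce
qed simp

lemma rma_sem_aut:
  assumes "events S \<subseteq> T"
  shows "M \<in> rma_sem aut S i \<longleftrightarrow>
    (\<exists>w. map fst w \<in> L \<and> wsat S i Map.empty w \<and> M = snd ` set w)"
proof -
  have linked: "linked S Map.empty Map.empty" by (simp add: linked_def)
  have "M \<in> rma_sem aut S i \<longleftrightarrow> (\<exists>st. steps_from aut S (i, enc L, Map.empty) st \<and>
    last_state (i, enc L, Map.empty) st \<in> finals aut \<and>
    match_of ((i, enc L, Map.empty), st) = M \<and>
    run_outputs ((i, enc L, Map.empty), st) \<noteq> [] \<and>
    last (run_outputs ((i, enc L, Map.empty), st)) = Mark)" (is "_ \<longleftrightarrow> (\<exists>st. ?R st)")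
    unfolding rma_sem_def is_run_def accepting_def last_state_def
    by (auto simp del: aut_simps(3))
  also have "\<dots> \<longleftrightarrow> (\<exists>w. map fst w \<in> L \<and> wsat S i Map.empty w \<and> M = snd ` set w)"
  proof
    assume "\<exists>st. ?R st"
    then obtain st where st: "?R st" by blast
    then obtain w where w: "wsat S i Map.empty w"
      "last_state (i, enc L, Map.empty) st = enc (derivs (map fst w) L)"
      "match_of ((i, enc L, Map.empty), st) = snd ` set w"
      using steps_word[OF assms _ L_residual linked] by blast
    \<comment> \<open>Being final only says that the state codes some residual with the empty word;
      injectivity of \<open>enc\<close> identifies it with the residual actually reached.\<close>
    obtain K where K: "enc (derivs (map fst w) L) = enc K" "K \<in> residuals" "[] \<in> K"
      using st w(2) by auto
    then have "[] \<in> derivs (map fst w) L" using inj_onD[OF inj_enc K(1)] by blast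
    then show "\<exists>w. map fst w \<in> L \<and> wsat S i Map.empty w \<and> M = snd ` set w"
      using w st by (intro exI[of _ w]) (simp add: derivs_def)
  next
    assume "\<exists>w. map fst w \<in> L \<and> wsat S i Map.empty w \<and> M = snd ` set w"
    then obtain w where w: "map fst w \<in> L" "wsat S i Map.empty w" "M = snd ` set w" by blast
    have "w \<noteq> []" using w(1) no_Nil by auto
    from word_steps[OF assms w(2) this w(1) L_residual linked] obtain st
      where "good_run S (i, enc L, Map.empty) (enc (derivs (map fst w) L)) M st"
      using w(3) by blast
    moreover have "[] \<in> derivs (map fst w) L" using w(1) by (simp add: derivs_def)
    then have "enc (derivs (map fst w) L) \<in> finals aut" by auto
    ultimately show "\<exists>st. ?R st" by (intro exI[of _ st]) (simp add: good_run_def)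
  qed
  finally show ?thesis .
qed

end

theorem theorem8:
  fixes Rel :: "'r set"
    and tuples :: "'e set"
    and ty :: "'e \<Rightarrow> 'r"
    and P :: "'e evpred set"
    and \<phi> :: "('r, 'e, 'x) cepl"
  assumes "cepl_setting Rel tuples ty P"
    and "cepl_over Rel P \<phi>"
    and "bounded \<phi>"
  shows "\<exists>A :: ('e, nat, nat) rma. is_rma P A \<and>
    (\<forall>S. events S \<subseteq> tuples \<longrightarrow>
      (\<forall>i M. M \<in> rma_sem A S i \<longleftrightarrow> (\<exists>v. M \<in> cepl_sem ty \<phi> S i v)))"
proof -
  let ?L = "lang tuples ty \<phi>"
  have reg: "regular ?L" by (rule regular_lang)
  \<comment> \<open>Only finitely many residuals and variables occur, so both can be coded by
    natural numbers whatever the types \<open>'e\<close> and \<open>'x\<close> are.\<close>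
  obtain enc :: "('e, 'x) letter list set \<Rightarrow> nat" where enc: "inj_on enc (range (\<lambda>u. derivs u ?L))"
    using finite_imp_inj_to_nat_seg[OF regular_finite(1)[OF reg]] by blast
  obtain reg :: "'x \<Rightarrow> nat"
    where reg: "inj_on reg (\<Union>u \<in> ?L. \<Union>(x, F, b) \<in> set u. insert x (fvars F))"
    using finite_imp_inj_to_nat_seg[OF regular_finite_vars[OF reg]] by blast
  interpret residual_automaton tuples P ?L enc reg
  proof
    show "formula_over P F" if "u \<in> ?L" "(x, F, b) \<in> set u" for u x F b
      using lang_formula_over[OF assms(1) that(1) assms(2) that(2)] .
    show "closed_word {} u" if "u \<in> ?L" for u using lang_closed[OF that assms(3)] .
  qed (fact cepl_setting.pred_TRUE[OF assms(1)] Nil_notin_lang regular_lang enc reg)+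
  show ?thesis
    by (intro exI[of _ aut] conjI allI impI is_rma_aut)
      (simp only: rma_sem_aut ex_cepl_sem_iff[OF _ assms(3)])
qed

end
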